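(* Let the perturbed system $\frac{dr}{dt}=f(r,\varphi,S(t),t)$, $\frac{d\varphi}{dt}=\omega(r)+g(r,\varphi,S(t),t)$ satisfy the conditions of the context (expansions of $f,g$, form of $S$, resonance condition), let $n\in[1,2q]$, $m\in[2,2q]$ be integers with $$\Lambda_i\equiv0\ (1\le i<n),\quad \Lambda_n\not\equiv0,\qquad \Omega_j\equiv0\ (1<j<m),\quad \Omega_m\not\equiv0,$$ and suppose $$\Lambda_n(\rho,\psi)\ne0\qquad\text{for all }(\rho,\psi)\in\mathbb R^2.$$ Then the solutions of the transformed system $$\frac{d\rho}{dt}=\Lambda_N(\rho,\psi,S(t),t),\qquad \frac{d\psi}{dt}=\Omega_N(\rho,\psi,S(t),t)$$ (with $N\ge n$, as described in the context) exit from any bounded domain of the $(\rho,\psi)$-plane in a finite time.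
   Context: $\mathbb Z_+$ denotes the positive integers. Setting. $\mathcal R>0$ is a constant. The functions $\omega(r)>0$, $f(r,\varphi,S,t)$, $g(r,\varphi,S,t)$ are infinitely differentiable, defined for all $|r|\le\mathcal R$, $(\varphi,S)\in\mathbb R^2$, $t>0$; $f,g$ are $2\pi$-periodic in $\varphi$ and in $S$; $\omega'\not\equiv0$. Asymptotic expansions: for some $q\in\mathbb Z_+$, $f\sim\sum_{j\ge1}t^{-j/q}f_j(r,\varphi,S)$, $g\sim\sum_{j\ge1}t^{-j/q}g_j(r,\varphi,S)$ as $t\to\infty$, with $f_j,g_j$ smooth and $2\pi$-periodic in $\varphi$ and $S$; i.e. for all $K\ge1$, $f-\sum_{j=1}^{K-1}t^{-j/q}f_j=\mathcal O(t^{-K/q})$ and $g-\sum_{j=1}^{K-1}t^{-j/q}g_j=\mathcal O(t^{-K/q})$ uniformly for $|r|\le\mathcal R$, $(\varphi,S)\in\mathbb R^2$. Phase: $S(t)=s_0t+\sum_{j=1}^{q-1}s_jt^{1-j/q}+s_q\log t$ with constants $s_j$, $s_0>0$. Resonance: there are $a$ with $0<|a|<\mathcal R$ and coprime $\kappa,\varkappa\in\mathbb Z_+$ with $\kappa s_0=\varkappa\omega(a)$ and $\eta:=\omega'(a)\ne0$. Averaged coefficients $\Lambda_k,\Omega_k$. Put $r=a+t^{-\frac1{2q}}R$, $\varphi=\frac\kappa\varkappa S(t)+\Psi$. Then $\frac{dR}{dt}=F(R,\Psi,S(t),t)$, $\frac{d\Psi}{dt}=G(R,\Psi,S(t),t)$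 with $F\sim\sum_{k\ge1}t^{-\frac k{2q}}F_k(R,\Psi,S)$, $G\sim\sum_{k\ge1}t^{-\frac k{2q}}G_k(R,\Psi,S)$, $$F_k=\sum_{i+2j=k+1,\,i\ge0,\,j\ge1}\partial_r^if_j\big(a,\tfrac\kappa\varkappa S+\Psi,S\big)\frac{R^i}{i!}+\delta_{k,2q}\frac R{2q},$$ $$G_k=\omega^{(k)}(a)\frac{R^k}{k!}-\frac\kappa\varkappa s_{k/2}\Big(1-\frac k{2q}+\delta_{k,2q}\Big)+\sum_{i+2j=k,\,i\ge0,\,j\ge1}\partial_r^ig_j\big(a,\tfrac\kappa\varkappa S+\Psi,S\big)\frac{R^i}{i!},$$ where $\delta_{k,2q}$ is the Kronecker delta, $s_j=0$ for $j>q$ and $s_{k/2}=0$ for odd $k$. There are unique functions $u_k,v_k$ of $(R,\Psi,S)$, $2\pi\varkappa$-periodic in $S$ with zero mean over $S\in[0,2\pi\varkappa]$, and unique functions $\Lambda_k,\Omega_k$ of two variables ($k\ge1$) determined recursively in $k$ by requiring that, with $U=R+\sum_{k\ge1}t^{-\frac k{2q}}u_k$, $V=\Psi+\sum_{k\ge1}t^{-\frac k{2q}}v_k$, the identities $$(F\partial_R+G\partial_\Psi+S'(t)\partial_S+\partial_t)U=\sum_{k\ge1}t^{-\frac k{2q}}\Lambda_k(U,V),\quad (F\partial_R+G\partial_\Psi+S'(t)\partial_S+\partial_t)V=\sum_{k\ge1}t^{-\frac k{2q}}\Omega_k(U,V)$$ hold as formal power series in $t^{-\frac1{2q}}$ (the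 right-hand sides Taylor-expanded at $(R,\Psi)$). In particular $\Lambda_1(\rho,\psi)=\frac1{2\pi\varkappa}\int_0^{2\pi\varkappa}f_1(a,\frac\kappa\varkappa S+\psi,S)\,dS$ and $\Omega_1(\rho,\psi)=\eta\rho$. Transformed system. For $N\in\mathbb Z_+$ let $$\rho(t)=R(t)+\sum_{k=1}^Nt^{-\frac k{2q}}u_k(R(t),\Psi(t),S(t)),\qquad \psi(t)=\Psi(t)+\sum_{k=1}^Nt^{-\frac k{2q}}v_k(R(t),\Psi(t),S(t)).$$ For fixed $\varsigma\in(0,1)$, $\epsilon\in(0,\mathcal R)$ and a sufficiently large $t_0\ge1$ this change of variables is invertible, with inverse defined for $(\rho,\psi,t)$ in $\mathcal D^\epsilon_{\varsigma,t_0}=\{(\rho,\psi,t)\in\mathbb R^3:\ |\rho t^{-\frac{1-\varsigma}{2q}}+a|<\mathcal R-\epsilon t^{-\frac{1-\varsigma}{2q}},\ t\ge t_0\}$, and the perturbed system becomes the transformed system of the claim, where $\Lambda_N(\rho,\psi,S,t)=\sum_{k=1}^Nt^{-\frac k{2q}}\Lambda_k(\rho,\psi)+\mathcal O(t^{-\frac{N+1}{2q}})$ and $\Omega_N(\rho,\psi,S,t)=\sum_{k=1}^Nt^{-\frac k{2q}}\Omega_k(\rho,\psi)+\mathcal O(t^{-\frac{N+1}{2q}})$ as $t\to\infty$, uniformly for bounded $\rho$ and all $(\psi,S)\in\mathbb R^2$. (The functions $\Lambda_N,\Omega_N$ of four arguments are the right-hand sides; $\Lambda_k,\Omega_k$ of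 two arguments are the averaged coefficients.) Meaning of the conclusion: for every bounded domain $B\subset\mathbb R^2$, no solution with $(\rho(t_1),\psi(t_1))\in B$ at some $t_1\ge t_0$ remains in $B$ for all $t\ge t_1$. *)

theory Defs
  imports "HOL-Analysis.Analysis" "HOL-Computational_Algebra.Formal_Power_Series"
begin

section \<open>Smooth functions\<close>

text \<open>
  \<open>S\<close> is meant to be convex with nonempty interior, so that the derivative within \<open>S\<close>
  is unique; at boundary points of \<open>S\<close> derivatives are one-sided.
\<close>

primrec Ck_on :: "nat \<Rightarrow> 'a::euclidean_space set \<Rightarrow> ('a \<Rightarrow> real) \<Rightarrow> bool" where
  "Ck_on 0 S h \<longleftrightarrow> continuous_on S h"
| "Ck_on (Suc k) S h \<longleftrightarrow>
     (\<exists>h'. (\<forall>x\<in>S. (h has_derivative h' x) (at x within S)) \<and>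
           (\<forall>b\<in>Basis. Ck_on k S (\<lambda>x. h' x b)))"

definition smooth_on :: "'a::euclidean_space set \<Rightarrow> ('a \<Rightarrow> real) \<Rightarrow> bool" where
  "smooth_on S h \<longleftrightarrow> (\<forall>k. Ck_on k S h)"


section \<open>The perturbed system\<close>

text \<open>
  The system is \<open>dr/dt = force r \<phi> S(t) t\<close>, \<open>d\<phi>/dt = freq r + shift r \<phi> S(t) t\<close>
  for \<open>\<bar>r\<bar> \<le> rad\<close>.  The functions \<open>force_coeff j\<close>, \<open>shift_coeff j\<close> (\<open>j \<ge> 1\<close>) are the
  coefficients of the expansions of \<open>force\<close> and \<open>shift\<close> in powers of \<open>t powr (-1/qq)\<close>;
  \<open>ph j\<close> (\<open>j \<le> qq\<close>) are the constants in the phase \<open>S(t)\<close>;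
  \<open>res\<close> is the resonant value of \<open>r\<close>, with \<open>kap * ph 0 = vkap * freq res\<close>.
\<close>

record perturbed_data =
  rad :: real
  freq :: "real \<Rightarrow> real"
  force :: "real \<Rightarrow> real \<Rightarrow> real \<Rightarrow> real \<Rightarrow> real"
  shift :: "real \<Rightarrow> real \<Rightarrow> real \<Rightarrow> real \<Rightarrow> real"
  force_coeff :: "nat \<Rightarrow> real \<Rightarrow> real \<Rightarrow> real \<Rightarrow> real"
  shift_coeff :: "nat \<Rightarrow> real \<Rightarrow> real \<Rightarrow> real \<Rightarrow> real"
  qq :: nat
  ph :: "nat \<Rightarrow> real"
  res :: real
  kap :: nat
  vkap :: nat

definition phase :: "perturbed_data \<Rightarrow> real \<Rightarrow> real" where
  "phase P t = ph P 0 * t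
     + (\<Sum>j\<in>{1..<qq P}. ph P j * t powr (1 - real j / real (qq P)))
     + ph P (qq P) * ln t"

definition asymp_expansion ::
  "real \<Rightarrow> nat \<Rightarrow> (real \<Rightarrow> real \<Rightarrow> real \<Rightarrow> real \<Rightarrow> real) \<Rightarrow>
    (nat \<Rightarrow> real \<Rightarrow> real \<Rightarrow> real \<Rightarrow> real) \<Rightarrow> bool" where
  "asymp_expansion \<rho>max q h hc \<longleftrightarrow>
     (\<forall>K\<ge>1. \<exists>C. \<forall>\<^sub>F t in at_top. \<forall>r \<phi> S. \<bar>r\<bar> \<le> \<rho>max \<longrightarrow>
        \<bar>h r \<phi> S t - (\<Sum>j\<in>{1..<K}. t powr (- (real j / real q)) * hc j r \<phi> S)\<bar>
          \<le> C * t powr (- (real K / real q)))"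

definition admissible_perturbation ::
  "real \<Rightarrow> nat \<Rightarrow> (real \<Rightarrow> real \<Rightarrow> real \<Rightarrow> real \<Rightarrow> real) \<Rightarrow>
    (nat \<Rightarrow> real \<Rightarrow> real \<Rightarrow> real \<Rightarrow> real) \<Rightarrow> bool" where
  "admissible_perturbation \<rho>max q h hc \<longleftrightarrow>
     smooth_on ({-\<rho>max..\<rho>max} \<times> UNIV \<times> UNIV \<times> {0<..}) (\<lambda>(r, \<phi>, S, t). h r \<phi> S t) \<and>
     (\<forall>r \<phi> S t. \<bar>r\<bar> \<le> \<rho>max \<and> t > 0 \<longrightarrow>
        h r (\<phi> + 2 * pi) S t = h r \<phi> S t \<and> h r \<phi> (S + 2 * pi) t = h r \<phi> S t) \<and>
     (\<forall>j\<ge>1. smooth_on ({-\<rho>max..\<rho>max} \<times> UNIV \<times> UNIV) (\<lambda>(r, \<phi>, S). hc j r \<phi> S)) \<and>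
     (\<forall>j\<ge>1. \<forall>r \<phi> S. \<bar>r\<bar> \<le> \<rho>max \<longrightarrow>
        hc j r (\<phi> + 2 * pi) S = hc j r \<phi> S \<and> hc j r \<phi> (S + 2 * pi) = hc j r \<phi> S) \<and>
     asymp_expansion \<rho>max q h hc"

definition perturbed_system :: "perturbed_data \<Rightarrow> bool" where
  "perturbed_system P \<longleftrightarrow>
     rad P > 0 \<and> qq P \<ge> 1 \<and> ph P 0 > 0 \<and>
     smooth_on {- rad P..rad P} (freq P) \<and>
     (\<forall>r. \<bar>r\<bar> \<le> rad P \<longrightarrow> freq P r > 0) \<and>
     (\<exists>r. \<bar>r\<bar> < rad P \<and> deriv (freq P) r \<noteq> 0) \<and>
     admissible_perturbation (rad P) (qq P) (force P) (force_coeff P) \<and>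
     admissible_perturbation (rad P) (qq P) (shift P) (shift_coeff P) \<and>
     0 < \<bar>res P\<bar> \<and> \<bar>res P\<bar> < rad P \<and>
     kap P \<ge> 1 \<and> vkap P \<ge> 1 \<and> coprime (kap P) (vkap P) \<and>
     real (kap P) * ph P 0 = real (vkap P) * freq P (res P) \<and>
     deriv (freq P) (res P) \<noteq> 0"

abbreviation ratio :: "perturbed_data \<Rightarrow> real" where
  "ratio P \<equiv> real (kap P) / real (vkap P)"


section \<open>The system near the resonance\<close>

text \<open>
  The substitution \<open>r = res + t powr (-1/(2 qq)) * R\<close>, \<open>\<phi> = ratio * S(t) + \<Psi>\<close> gives
  \<open>dR/dt = Fres R \<Psi> S(t) t\<close>, \<open>d\<Psi>/dt = Gres R \<Psi> S(t) t\<close>.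
\<close>

definition Fres :: "perturbed_data \<Rightarrow> real \<Rightarrow> real \<Rightarrow> real \<Rightarrow> real \<Rightarrow> real" where
  "Fres P R \<Psi> S t =
     t powr (1 / (2 * real (qq P)))
       * force P (res P + t powr (- 1 / (2 * real (qq P))) * R) (ratio P * S + \<Psi>) S t
     + R / (2 * real (qq P) * t)"

definition Gres :: "perturbed_data \<Rightarrow> real \<Rightarrow> real \<Rightarrow> real \<Rightarrow> real \<Rightarrow> real" where
  "Gres P R \<Psi> S t =
     freq P (res P + t powr (- 1 / (2 * real (qq P))) * R)
     + shift P (res P + t powr (- 1 / (2 * real (qq P))) * R) (ratio P * S + \<Psi>) S t
     - ratio P * deriv (phase P) t"

text \<open>
  The coefficient of \<open>t powr (-k/(2 qq))\<close> in \<open>S'(t)\<close>, that is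
  \<open>s\<^bsub>k/2\<^esub> (1 - k/(2q) + \<delta>\<^bsub>k,2q\<^esub>)\<close> with \<open>s\<^bsub>k/2\<^esub> = 0\<close> for odd \<open>k\<close> and for \<open>k > 2q\<close>.
\<close>

definition dphase_coeff :: "perturbed_data \<Rightarrow> nat \<Rightarrow> real" where
  "dphase_coeff P k =
     (if even k \<and> k \<le> 2 * qq P
      then ph P (k div 2)
             * (1 - real k / (2 * real (qq P)) + (if k = 2 * qq P then 1 else 0))
      else 0)"

text \<open>
  The coefficients of the expansions of \<open>Fres\<close> and \<open>Gres\<close>.  At \<open>k = 0\<close> the first is
  trivially zero and the second is zero by the resonance condition, so both may be used as
  the coefficient sequences of series that start with \<open>k = 1\<close>.
\<close>

definition Fcoeff :: "perturbed_data \<Rightarrow> nat \<Rightarrow> real \<Rightarrow> real \<Rightarrow> real \<Rightarrow> real" where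
  "Fcoeff P k R \<Psi> S =
     (\<Sum>(i, j)\<in>{(i, j). i + 2 * j = k + 1 \<and> 1 \<le> j}.
        (deriv ^^ i) (\<lambda>r. force_coeff P j r (ratio P * S + \<Psi>) S) (res P) * R ^ i / fact i)
     + (if k = 2 * qq P then R / (2 * real (qq P)) else 0)"

definition Gcoeff :: "perturbed_data \<Rightarrow> nat \<Rightarrow> real \<Rightarrow> real \<Rightarrow> real \<Rightarrow> real" where
  "Gcoeff P k R \<Psi> S =
     (deriv ^^ k) (freq P) (res P) * R ^ k / fact k
     - ratio P * dphase_coeff P k
     + (\<Sum>(i, j)\<in>{(i, j). i + 2 * j = k \<and> 1 \<le> j}.
          (deriv ^^ i) (\<lambda>r. shift_coeff P j r (ratio P * S + \<Psi>) S) (res P) * R ^ i / fact i)"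


section \<open>Averaging\<close>

text \<open>
  Formal series are power series in \<open>x = t powr (-1/(2 qq))\<close>, taken at a fixed point
  \<open>(R, \<Psi>, S)\<close>.  For the series with coefficient functions \<open>W k R \<Psi> S\<close>,
  \<open>formal_total_deriv\<close> is its image under \<open>F \<partial>\<^sub>R + G \<partial>\<^sub>\<Psi> + S'(t) \<partial>\<^sub>S + \<partial>\<^sub>t\<close>; the last
  summand comes from \<open>d/dt x ^ k = - (k / (2 qq)) * x ^ (k + 2 * qq)\<close>.
\<close>

definition formal_total_deriv ::
  "perturbed_data \<Rightarrow> (nat \<Rightarrow> real \<Rightarrow> real \<Rightarrow> real \<Rightarrow> real) \<Rightarrow> real \<Rightarrow> real \<Rightarrow> real \<Rightarrow> real fps" where
  "formal_total_deriv P W R \<Psi> S =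
     Abs_fps (\<lambda>k. Fcoeff P k R \<Psi> S) * Abs_fps (\<lambda>k. deriv (\<lambda>R'. W k R' \<Psi> S) R)
     + Abs_fps (\<lambda>k. Gcoeff P k R \<Psi> S) * Abs_fps (\<lambda>k. deriv (\<lambda>\<Psi>'. W k R \<Psi>' S) \<Psi>)
     + Abs_fps (dphase_coeff P) * Abs_fps (\<lambda>k. deriv (\<lambda>S'. W k R \<Psi> S') S)
     + fps_X ^ (2 * qq P) * Abs_fps (\<lambda>k. - (real k / (2 * real (qq P))) * W k R \<Psi> S)"

text \<open>
  The Taylor expansion of \<open>H (R + h) (\<Psi> + l)\<close> at \<open>(R, \<Psi>)\<close> for formal series \<open>h\<close>, \<open>l\<close>
  without constant term; then \<open>h ^ i * l ^ j\<close> contributes to the coefficient of \<open>x ^ d\<close>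
  only if \<open>i + j \<le> d\<close>.
\<close>

definition formal_taylor ::
  "(real \<Rightarrow> real \<Rightarrow> real) \<Rightarrow> real \<Rightarrow> real \<Rightarrow> real fps \<Rightarrow> real fps \<Rightarrow> real fps" where
  "formal_taylor H R \<Psi> h l = Abs_fps (\<lambda>d.
     \<Sum>i\<le>d. \<Sum>j\<le>d.
       (deriv ^^ i) (\<lambda>R'. (deriv ^^ j) (\<lambda>\<Psi>'. H R' \<Psi>') \<Psi>) R / (fact i * fact j)
         * fps_nth (h ^ i * l ^ j) d)"

definition fps_from_1 :: "(nat \<Rightarrow> real) \<Rightarrow> real fps" where
  "fps_from_1 c = Abs_fps (\<lambda>k. if k = 0 then 0 else c k)"

text \<open>The series \<open>\<Sum>k\<ge>1. x ^ k * H k U V\<close> with \<open>U = R + \<Sum>k\<ge>1. x ^ k * u k\<close> and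
  \<open>V = \<Psi> + \<Sum>k\<ge>1. x ^ k * v k\<close>.\<close>

definition averaged_series ::
  "(nat \<Rightarrow> real \<Rightarrow> real \<Rightarrow> real \<Rightarrow> real) \<Rightarrow> (nat \<Rightarrow> real \<Rightarrow> real \<Rightarrow> real \<Rightarrow> real) \<Rightarrow>
    (nat \<Rightarrow> real \<Rightarrow> real \<Rightarrow> real) \<Rightarrow> real \<Rightarrow> real \<Rightarrow> real \<Rightarrow> real fps" where
  "averaged_series u v H R \<Psi> S = Abs_fps (\<lambda>d.
     \<Sum>k\<in>{1..d}. fps_nth (formal_taylor (H k) R \<Psi>
       (fps_from_1 (\<lambda>k. u k R \<Psi> S)) (fps_from_1 (\<lambda>k. v k R \<Psi> S))) (d - k))"

text \<open>
  The conditions that determine \<open>u k, v k, \<Lambda> k, \<Omega> k\<close> for \<open>k \<ge> 1\<close>; the values at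
  \<open>k = 0\<close> are irrelevant.
\<close>

definition averaging ::
  "perturbed_data \<Rightarrow>
    (nat \<Rightarrow> real \<Rightarrow> real \<Rightarrow> real \<Rightarrow> real) \<Rightarrow> (nat \<Rightarrow> real \<Rightarrow> real \<Rightarrow> real \<Rightarrow> real) \<Rightarrow>
    (nat \<Rightarrow> real \<Rightarrow> real \<Rightarrow> real) \<Rightarrow> (nat \<Rightarrow> real \<Rightarrow> real \<Rightarrow> real) \<Rightarrow> bool" where
  "averaging P u v \<Lambda> \<Omega> \<longleftrightarrow>
     (\<forall>w\<in>{u, v}. \<forall>k\<ge>1.
        smooth_on UNIV (\<lambda>(R, \<Psi>, S). w k R \<Psi> S) \<and>
        (\<forall>R \<Psi> S. w k R \<Psi> (S + 2 * pi * real (vkap P)) = w k R \<Psi> S) \<and>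
        (\<forall>R \<Psi>. ((\<lambda>S. w k R \<Psi> S) has_integral 0) {0..2 * pi * real (vkap P)})) \<and>
     (\<forall>H\<in>{\<Lambda>, \<Omega>}. \<forall>k\<ge>1. smooth_on UNIV (\<lambda>(\<rho>, \<psi>). H k \<rho> \<psi>)) \<and>
     (\<forall>R \<Psi> S. formal_total_deriv P (u(0 := \<lambda>R \<Psi> S. R)) R \<Psi> S
                = averaged_series u v \<Lambda> R \<Psi> S) \<and>
     (\<forall>R \<Psi> S. formal_total_deriv P (v(0 := \<lambda>R \<Psi> S. \<Psi>)) R \<Psi> S
                = averaged_series u v \<Omega> R \<Psi> S)"


section \<open>The transformed system\<close>

definition Utrunc ::
  "perturbed_data \<Rightarrow> (nat \<Rightarrow> real \<Rightarrow> real \<Rightarrow> real \<Rightarrow> real) \<Rightarrow> nat \<Rightarrow>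
    real \<Rightarrow> real \<Rightarrow> real \<Rightarrow> real \<Rightarrow> real" where
  "Utrunc P u N R \<Psi> S t =
     R + (\<Sum>k=1..N. t powr (- (real k / (2 * real (qq P)))) * u k R \<Psi> S)"

definition Vtrunc ::
  "perturbed_data \<Rightarrow> (nat \<Rightarrow> real \<Rightarrow> real \<Rightarrow> real \<Rightarrow> real) \<Rightarrow> nat \<Rightarrow>
    real \<Rightarrow> real \<Rightarrow> real \<Rightarrow> real \<Rightarrow> real" where
  "Vtrunc P v N R \<Psi> S t =
     \<Psi> + (\<Sum>k=1..N. t powr (- (real k / (2 * real (qq P)))) * v k R \<Psi> S)"

definition change_vars ::
  "perturbed_data \<Rightarrow> (nat \<Rightarrow> real \<Rightarrow> real \<Rightarrow> real \<Rightarrow> real) \<Rightarrow>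
    (nat \<Rightarrow> real \<Rightarrow> real \<Rightarrow> real \<Rightarrow> real) \<Rightarrow> nat \<Rightarrow> real \<Rightarrow> real \<Rightarrow> real \<times> real \<Rightarrow> real \<times> real" where
  "change_vars P u v N S t = (\<lambda>(R, \<Psi>). (Utrunc P u N R \<Psi> S t, Vtrunc P v N R \<Psi> S t))"

definition total_deriv ::
  "perturbed_data \<Rightarrow> (real \<Rightarrow> real \<Rightarrow> real \<Rightarrow> real \<Rightarrow> real) \<Rightarrow>
    real \<Rightarrow> real \<Rightarrow> real \<Rightarrow> real \<Rightarrow> real" where
  "total_deriv P W R \<Psi> S t =
     Fres P R \<Psi> S t * deriv (\<lambda>R'. W R' \<Psi> S t) R
     + Gres P R \<Psi> S t * deriv (\<lambda>\<Psi>'. W R \<Psi>' S t) \<Psi>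
     + deriv (phase P) t * deriv (\<lambda>S'. W R \<Psi> S' t) S
     + deriv (\<lambda>t'. W R \<Psi> S t') t"

text \<open>The section at time \<open>t\<close> of the domain \<open>\<D>\<^sup>\<epsilon>\<close> (without the condition \<open>t \<ge> t0\<close>).\<close>

definition dom_at :: "perturbed_data \<Rightarrow> real \<Rightarrow> real \<Rightarrow> real \<Rightarrow> (real \<times> real) set" where
  "dom_at P \<sigma> \<epsilon> t = {(\<rho>, \<psi>).
     \<bar>\<rho> * t powr (- ((1 - \<sigma>) / (2 * real (qq P)))) + res P\<bar>
       < rad P - \<epsilon> * t powr (- ((1 - \<sigma>) / (2 * real (qq P))))}"

text \<open>
  The change of variables is considered for \<open>(R, \<Psi>)\<close> in the corresponding domain with
  \<open>\<epsilon> = 0\<close> (for \<open>t \<ge> 1\<close> there \<open>\<bar>res + t powr (-1/(2 qq)) * R\<bar> < rad\<close>, so that \<open>Fres\<close> and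
  \<open>Gres\<close> are evaluated inside the domain of the system).  It moves points by less than
  \<open>\<epsilon>\<close> for large \<open>t\<close>, whence the shrunken domain \<open>\<D>\<^sup>\<epsilon>\<close> of its inverse.
\<close>

definition change_invertible ::
  "perturbed_data \<Rightarrow> (nat \<Rightarrow> real \<Rightarrow> real \<Rightarrow> real \<Rightarrow> real) \<Rightarrow>
    (nat \<Rightarrow> real \<Rightarrow> real \<Rightarrow> real \<Rightarrow> real) \<Rightarrow> nat \<Rightarrow> real \<Rightarrow> real \<Rightarrow> real \<Rightarrow> bool" where
  "change_invertible P u v N \<sigma> \<epsilon> t0 \<longleftrightarrow>
     (\<forall>t\<ge>t0. inj_on (change_vars P u v N (phase P t) t) (dom_at P \<sigma> 0 t) \<and>
        dom_at P \<sigma> \<epsilon> t \<subseteq> change_vars P u v N (phase P t) t ` dom_at P \<sigma> 0 t)"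

definition change_inv ::
  "perturbed_data \<Rightarrow> (nat \<Rightarrow> real \<Rightarrow> real \<Rightarrow> real \<Rightarrow> real) \<Rightarrow>
    (nat \<Rightarrow> real \<Rightarrow> real \<Rightarrow> real \<Rightarrow> real) \<Rightarrow> nat \<Rightarrow> real \<Rightarrow> real \<Rightarrow> real \<Rightarrow> real \<times> real \<Rightarrow> real \<times> real" where
  "change_inv P u v N \<sigma> S t = the_inv_into (dom_at P \<sigma> 0 t) (change_vars P u v N S t)"

definition \<Lambda>_rhs ::
  "perturbed_data \<Rightarrow> (nat \<Rightarrow> real \<Rightarrow> real \<Rightarrow> real \<Rightarrow> real) \<Rightarrow>
    (nat \<Rightarrow> real \<Rightarrow> real \<Rightarrow> real \<Rightarrow> real) \<Rightarrow> nat \<Rightarrow> real \<Rightarrow>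
    real \<Rightarrow> real \<Rightarrow> real \<Rightarrow> real \<Rightarrow> real" where
  "\<Lambda>_rhs P u v N \<sigma> \<rho> \<psi> S t =
     (case change_inv P u v N \<sigma> S t (\<rho>, \<psi>) of (R, \<Psi>) \<Rightarrow> total_deriv P (Utrunc P u N) R \<Psi> S t)"

definition \<Omega>_rhs ::
  "perturbed_data \<Rightarrow> (nat \<Rightarrow> real \<Rightarrow> real \<Rightarrow> real \<Rightarrow> real) \<Rightarrow>
    (nat \<Rightarrow> real \<Rightarrow> real \<Rightarrow> real \<Rightarrow> real) \<Rightarrow> nat \<Rightarrow> real \<Rightarrow>
    real \<Rightarrow> real \<Rightarrow> real \<Rightarrow> real \<Rightarrow> real" where
  "\<Omega>_rhs P u v N \<sigma> \<rho> \<psi> S t =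
     (case change_inv P u v N \<sigma> S t (\<rho>, \<psi>) of (R, \<Psi>) \<Rightarrow> total_deriv P (Vtrunc P v N) R \<Psi> S t)"

definition transformed_solution ::
  "perturbed_data \<Rightarrow> (nat \<Rightarrow> real \<Rightarrow> real \<Rightarrow> real \<Rightarrow> real) \<Rightarrow>
    (nat \<Rightarrow> real \<Rightarrow> real \<Rightarrow> real \<Rightarrow> real) \<Rightarrow> nat \<Rightarrow> real \<Rightarrow> real \<Rightarrow> real \<Rightarrow>
    (real \<Rightarrow> real) \<Rightarrow> (real \<Rightarrow> real) \<Rightarrow> bool" where
  "transformed_solution P u v N \<sigma> \<epsilon> t1 \<rho> \<psi> \<longleftrightarrow>
     (\<forall>t\<ge>t1. (\<rho> t, \<psi> t) \<in> dom_at P \<sigma> \<epsilon> t \<and>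
        (\<rho> has_real_derivative \<Lambda>_rhs P u v N \<sigma> (\<rho> t) (\<psi> t) (phase P t) t) (at t within {t1..}) \<and>
        (\<psi> has_real_derivative \<Omega>_rhs P u v N \<sigma> (\<rho> t) (\<psi> t) (phase P t) t) (at t within {t1..}))"

end

(*
  A trajectory that stays in a bounded set gives, after inverting the change of variables,
  bounded functions R(t), Psi(t): the change is a small perturbation of the identity on compact
  sets, so a bounded preimage exists by Brouwer's theorem and it is the only one by injectivity.
  Along bounded functions all ingredients of the total derivative of the truncated U have
  asymptotic expansions in x = t powr (-1/(2q)); multiplying these out gives the formal series
  of the averaging procedure, whose lowest nonzero term is x^n Lambda_n.  Hence
  rho' = x^n (Lambda_n(R, Psi) + O(x)), and since |Lambda_n| is bounded below on compact sets and
  x^n >= 1/t (as n <= 2q), |rho| grows at least like a multiple of ln t.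
*)

theory Submission
  imports Defs "HOL-Library.Landau_Symbols" "HOL-Library.Periodic_Fun"
begin

text \<open>The averaging identity is one of formal series at a fixed point
  \<open>(R, \<Psi>, S)\<close>, whereas along a solution all three arguments move and
  \<open>S\<close> grows without bound. To draw an estimate from it, every remainder needs a
  constant independent of the point: boundedness controls \<open>R\<close> and
  \<open>\<Psi>\<close>, periodicity controls the angles. This is why the expansions have
  coefficients that are themselves functions of time. The leading coefficient stays at
  \<open>(R, \<Psi>)\<close> and is not rewritten at \<open>(\<rho>, \<psi>)\<close>. The inverse
  change of variables is therefore never expanded or differentiated; a bound on its values is
  enough. Derivatives in the averaged coefficients are two-sided, while smoothness is given on the
  closed strip \<open>\<bar>r\<bar> \<le> rad\<close>. All expansions are placed around the interior
  point \<open>res\<close>, in a closed ball that keeps a positive distance from the edge.\<close>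

section \<open>Iterated partial derivatives of smooth functions\<close>

lemma Ck_on_continuous:
  assumes "Ck_on k S h"
  shows "continuous_on S h"
proof (cases k)
  case (Suc l)
  then show ?thesis
    using assms by (auto simp: continuous_on_eq_continuous_within intro: has_derivative_continuous)
qed (use assms in simp)

lemma Ck_on_partial:
  fixes h :: "'a::euclidean_space \<Rightarrow> real"
  assumes "Ck_on (Suc k) S h" "e \<in> Basis"
  obtains g where "Ck_on k S g"
    and "\<And>p r. p + r *\<^sub>R e \<in> interior S \<Longrightarrow>
           ((\<lambda>r. h (p + r *\<^sub>R e)) has_real_derivative g (p + r *\<^sub>R e)) (at r)"
proof -
  obtain h' where h': "\<And>x. x \<in> S \<Longrightarrow> (h has_derivative h' x) (at x within S)"
    and Ck: "\<And>b. b \<in> Basis \<Longrightarrow> Ck_on k S (\<lambda>x. h' x b)"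
    using assms(1) by auto
  show ?thesis
  proof (rule that)
    show "Ck_on k S (\<lambda>x. h' x e)" using Ck assms(2) .
    fix p r assume *: "p + r *\<^sub>R e \<in> interior S"
    have D: "(h has_derivative h' (p + r *\<^sub>R e)) (at (p + r *\<^sub>R e))"
      using h'[of "p + r *\<^sub>R e"] * by (metis at_within_interior interior_subset subsetD)
    have "((\<lambda>r. h (p + r *\<^sub>R e)) has_derivative (\<lambda>d. h' (p + r *\<^sub>R e) (d *\<^sub>R e))) (at r)"
      by (rule has_derivative_compose[where f="\<lambda>r. p + r *\<^sub>R e" and g=h, OF _ D]) (auto intro!: derivative_eq_intros)
    moreover have "h' (p + r *\<^sub>R e) (d *\<^sub>R e) = d * h' (p + r *\<^sub>R e) e" for d
      using linear_scale[OF has_derivative_linear[OF D]] by simp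
    ultimately show "((\<lambda>r. h (p + r *\<^sub>R e)) has_real_derivative h' (p + r *\<^sub>R e) e) (at r)"
      by (simp add: has_field_derivative_def mult_commute_abs)
  qed
qed

text \<open>Iterated \<open>deriv\<close> acts on functions of one real variable, so a partial
  derivative is taken along the line through \<open>p\<close> in direction \<open>e\<close>. The
  point is that one \<open>g\<close> serves all base points \<open>p\<close>; its continuity is
  joint continuity, which the compactness arguments need. Interior points form an open set, so the
  inductive formula holds near \<open>r\<close> and may be differentiated.\<close>

lemma Ck_on_higher_partial:
  fixes h :: "'a::euclidean_space \<Rightarrow> real"
  assumes "Ck_on (i + k) S h" "e \<in> Basis"
  shows "\<exists>g. Ck_on k S g \<and> (\<forall>p r. p + r *\<^sub>R e \<in> interior S \<longrightarrow>
            (deriv ^^ i) (\<lambda>r. h (p + r *\<^sub>R e)) r = g (p + r *\<^sub>R e))"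
  using assms(1)
proof (induction i arbitrary: k)
  case (Suc i)
  then obtain g where g: "Ck_on (Suc k) S g"
      "\<And>p r. p + r *\<^sub>R e \<in> interior S \<Longrightarrow>
            (deriv ^^ i) (\<lambda>r. h (p + r *\<^sub>R e)) r = g (p + r *\<^sub>R e)"
    by (metis add_Suc_shift)
  from Ck_on_partial[OF g(1) assms(2)] obtain g' where g': "Ck_on k S g'"
    "\<And>p r. p + r *\<^sub>R e \<in> interior S \<Longrightarrow>
           ((\<lambda>r. g (p + r *\<^sub>R e)) has_real_derivative g' (p + r *\<^sub>R e)) (at r)"
    by metis
  have "(deriv ^^ Suc i) (\<lambda>r. h (p + r *\<^sub>R e)) r = g' (p + r *\<^sub>R e)"
    if *: "p + r *\<^sub>R e \<in> interior S" for p r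
  proof -
    have "open ((\<lambda>r. p + r *\<^sub>R e) -` interior S)"
      by (intro open_vimage open_interior continuous_intros)
    then have "\<forall>\<^sub>F y in nhds r. y \<in> (\<lambda>r. p + r *\<^sub>R e) -` interior S"
      using * by (intro eventually_nhds_in_open) auto
    then have "\<forall>\<^sub>F y in nhds r. (deriv ^^ i) (\<lambda>r. h (p + r *\<^sub>R e)) y = g (p + y *\<^sub>R e)"
      by eventually_elim (use g in auto)
    then have "deriv ((deriv ^^ i) (\<lambda>r. h (p + r *\<^sub>R e))) r = deriv (\<lambda>r. g (p + r *\<^sub>R e)) r"
      by (intro deriv_cong_ev) auto
    then show ?thesis using g'(2)[OF *] by (simp add: DERIV_imp_deriv)
  qed
  then show ?case using g'(1) by blast
qed auto

lemma smooth_on_higher_partial: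
  fixes h :: "'a::euclidean_space \<Rightarrow> real"
  assumes "smooth_on S h" "e \<in> Basis"
  obtains g where "continuous_on S g"
    and "\<And>p r. p + r *\<^sub>R e \<in> interior S \<Longrightarrow>
           (deriv ^^ i) (\<lambda>r. h (p + r *\<^sub>R e)) r = g (p + r *\<^sub>R e)"
  using Ck_on_higher_partial[of i 0 S h e] assms unfolding smooth_on_def by auto

lemma smooth_on_higher_partial_differentiable:
  fixes h :: "'a::euclidean_space \<Rightarrow> real"
  assumes "smooth_on S h" "e \<in> Basis" and *: "p + r *\<^sub>R e \<in> interior S"
  shows "((deriv ^^ i) (\<lambda>r. h (p + r *\<^sub>R e)) has_real_derivative
           (deriv ^^ Suc i) (\<lambda>r. h (p + r *\<^sub>R e)) r) (at r)"
proof -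
  have "Ck_on (i + Suc 0) S h" using assms(1) unfolding smooth_on_def by blast
  from Ck_on_higher_partial[OF this assms(2)]
  obtain g where g: "Ck_on (Suc 0) S g"
      "\<And>p r. p + r *\<^sub>R e \<in> interior S \<Longrightarrow>
            (deriv ^^ i) (\<lambda>r. h (p + r *\<^sub>R e)) r = g (p + r *\<^sub>R e)"
    by metis
  from Ck_on_partial[OF g(1) assms(2)] obtain g' where g': 
    "((\<lambda>r. g (p + r *\<^sub>R e)) has_real_derivative g' (p + r *\<^sub>R e)) (at r)"
    using * by metis
  have "open ((\<lambda>r. p + r *\<^sub>R e) -` interior S)"
    by (intro open_vimage open_interior continuous_intros)
  then have "\<forall>\<^sub>F y in nhds r. y \<in> (\<lambda>r. p + r *\<^sub>R e) -` interior S"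
    using * by (intro eventually_nhds_in_open) auto
  then have "\<forall>\<^sub>F y in nhds r. (deriv ^^ i) (\<lambda>r. h (p + r *\<^sub>R e)) y = g (p + y *\<^sub>R e)"
    by eventually_elim (use g in auto)
  from DERIV_cong_ev[OF refl this refl, of "g' (p + r *\<^sub>R e)"] g'
  have "((deriv ^^ i) (\<lambda>r. h (p + r *\<^sub>R e)) has_real_derivative g' (p + r *\<^sub>R e)) (at r)"
    by simp
  then show ?thesis by (simp add: DERIV_imp_deriv)
qed

lemma periodic_representative:
  fixes h :: "real \<Rightarrow> 'b"
  assumes "\<And>s. h (s + T) = h s" "T > 0"
  obtains s0 where "s0 \<in> {0..T}" "h s0 = h s"
proof -
  interpret periodic_fun_simple h T by standard (rule assms)
  let ?k = "\<lfloor>s / T\<rfloor>"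
  have "s - of_int ?k * T \<in> {0..T}"
    using assms(2) floor_divide_lower[OF assms(2), of s] floor_divide_upper[OF assms(2), of s]
    by (auto simp: algebra_simps)
  moreover have "h (s - of_int ?k * T) = h s" by (rule minus_of_int)
  ultimately show ?thesis using that by blast
qed

section \<open>Calculus of expansions in powers of a small quantity\<close>

text \<open>The coefficients may vary with the point \<open>w\<close>, provided that they stay bounded along \<open>F\<close>;
  so one can expand along a trajectory, and no uniformity in parameters has to be tracked.\<close>

definition expands ::
  "'c filter \<Rightarrow> ('c \<Rightarrow> real) \<Rightarrow> nat \<Rightarrow> ('c \<Rightarrow> real) \<Rightarrow> ('c \<Rightarrow> real fps) \<Rightarrow> bool" where
  "expands F x n A a \<longleftrightarrow>
     (\<lambda>w. A w - (\<Sum>k\<le>n. fps_nth (a w) k * x w ^ k)) \<in> O[F](\<lambda>w. x w ^ Suc n) \<and>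
     (\<forall>k\<le>n. (\<lambda>w. fps_nth (a w) k) \<in> O[F](\<lambda>_. 1))"

lemma power_bigo_power:
  fixes x :: "'c \<Rightarrow> real"
  assumes "x \<in> O[F](\<lambda>_. 1)" "n \<le> m"
  shows "(\<lambda>w. x w ^ m) \<in> O[F](\<lambda>w. x w ^ n)"
proof -
  have "(\<lambda>w. x w ^ n * x w ^ (m - n)) \<in> O[F](\<lambda>w. x w ^ n * 1 ^ (m - n))"
    by (intro landau_o.big.mult landau_o.big_power assms(1)) auto
  then show ?thesis using assms(2) by (simp flip: power_add)
qed

lemma expands_cong:
  assumes "expands F x n A a"
    and "\<forall>\<^sub>F w in F. A w = B w" "\<forall>\<^sub>F w in F. \<forall>k\<le>n. fps_nth (a w) k = fps_nth (b w) k"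
  shows "expands F x n B b"
proof -
  have "\<forall>\<^sub>F w in F. A w - (\<Sum>k\<le>n. fps_nth (a w) k * x w ^ k)
      = B w - (\<Sum>k\<le>n. fps_nth (b w) k * x w ^ k)"
    using assms(2,3) by eventually_elim auto
  note this[THEN landau_o.big.in_cong]
  moreover have "(\<lambda>w. fps_nth (a w) k) \<in> O[F](\<lambda>_. 1) \<longleftrightarrow> (\<lambda>w. fps_nth (b w) k) \<in> O[F](\<lambda>_. 1)"
    if "k \<le> n" for k
    by (rule landau_o.big.in_cong) (use assms(3) that in \<open>auto elim: eventually_mono\<close>)
  ultimately show ?thesis
    using assms(1) unfolding expands_def by blast
qed

lemma expands_add:
  assumes "expands F x n A a" "expands F x n B b"
  shows "expands F x n (\<lambda>w. A w + B w) (\<lambda>w. a w + b w)"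
proof -
  have "(\<lambda>w. (A w - (\<Sum>k\<le>n. fps_nth (a w) k * x w ^ k)) +
       (B w - (\<Sum>k\<le>n. fps_nth (b w) k * x w ^ k))) \<in> O[F](\<lambda>w. x w ^ Suc n)"
    using assms unfolding expands_def by (intro sum_in_bigo(1)) auto
  then show ?thesis
    using assms unfolding expands_def
    by (auto simp: algebra_simps sum.distrib intro!: sum_in_bigo(1))
qed

lemma expands_sum:
  assumes "\<And>i. i \<in> I \<Longrightarrow> expands F x n (A i) (a i)"
  shows "expands F x n (\<lambda>w. \<Sum>i\<in>I. A i w) (\<lambda>w. \<Sum>i\<in>I. a i w)"
  using assms
proof (induction I rule: infinite_finite_induct)
  case (insert i I)
  then show ?case using expands_add[of F x n "A i" "a i"] by simp
qed (simp_all add: expands_def)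

lemma expands_poly_bigo_1:
  assumes "expands F x n A a" "x \<in> O[F](\<lambda>_. 1)"
  shows "(\<lambda>w. \<Sum>k\<le>n. fps_nth (a w) k * x w ^ k) \<in> O[F](\<lambda>_. 1)"
proof (rule big_sum_in_bigo)
  fix k assume "k \<in> {..n}"
  then have "(\<lambda>w. fps_nth (a w) k * x w ^ k) \<in> O[F](\<lambda>_. 1 * 1 ^ k)"
    using assms unfolding expands_def by (intro landau_o.big.mult landau_o.big_power) auto
  then show "(\<lambda>w. fps_nth (a w) k * x w ^ k) \<in> O[F](\<lambda>_. 1)" by simp
qed

lemma expands_bigo_1:
  assumes "expands F x n A a" "x \<in> O[F](\<lambda>_. 1)"
  shows "A \<in> O[F](\<lambda>_. 1)"
proof -
  have "(\<lambda>w. A w - (\<Sum>k\<le>n. fps_nth (a w) k * x w ^ k)) \<in> O[F](\<lambda>_. 1)"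
    using assms(1) power_bigo_power[OF assms(2), of 0 "Suc n"] unfolding expands_def
    by (auto intro: landau_o.big_trans)
  from sum_in_bigo(1)[OF this expands_poly_bigo_1[OF assms]] show ?thesis by simp
qed

text \<open>With \<open>?p\<close> denoting truncation, the error is
  \<open>(A - ?p a) * B + ?p a * (B - ?p b)\<close> plus the terms of \<open>?p a * ?p b\<close> of
  degree above \<open>n\<close>, indexed by \<open>?R\<close>. Each part is a remainder or a power
  above \<open>n\<close> times something bounded.\<close>

lemma expands_mult:
  assumes A: "expands F x n A a" and B: "expands F x n B b" and x: "x \<in> O[F](\<lambda>_. 1)"
  shows "expands F x n (\<lambda>w. A w * B w) (\<lambda>w. a w * b w)"
proof -
  let ?p = "\<lambda>a w. \<Sum>k\<le>n. fps_nth (a w) k * x w ^ k"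
  let ?R = "{(i, j). i \<le> n \<and> j \<le> n \<and> n < i + j}"
  have fin: "finite ?R" by (rule finite_subset[of _ "{..n} \<times> {..n}"]) auto
  have ab: "(\<lambda>w. fps_nth (a w) i * fps_nth (b w) j) \<in> O[F](\<lambda>_. 1)" if "i \<le> n" "j \<le> n" for i j
    using A B that landau_o.big.mult[of "\<lambda>w. fps_nth (a w) i" F "\<lambda>_. 1" "\<lambda>w. fps_nth (b w) j" "\<lambda>_. 1"]
    unfolding expands_def by auto
  have prod: "?p a w * ?p b w - ?p (\<lambda>w. a w * b w) w
      = (\<Sum>(i,j)\<in>?R. fps_nth (a w) i * fps_nth (b w) j * x w ^ (i + j))" for w
  proof -
    let ?f = "\<lambda>(i,j). fps_nth (a w) i * fps_nth (b w) j * x w ^ (i + j)"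
    have "?p a w * ?p b w = (\<Sum>ij\<in>{..n} \<times> {..n}. ?f ij)"
      by (simp add: sum_product sum.cartesian_product power_add mult_ac)
    also have "{..n} \<times> {..n} = {(i,j). i + j \<le> n} \<union> ?R" by auto
    also have "sum ?f \<dots> = sum ?f {(i,j). i + j \<le> n} + sum ?f ?R"
      by (rule sum.union_disjoint)
         (auto intro: fin finite_subset[of _ "{..n} \<times> {..n}"])
    also have "sum ?f {(i,j). i + j \<le> n} = ?p (\<lambda>w. a w * b w) w"
      by (subst sum.triangle_reindex_eq)
         (auto simp: fps_mult_nth sum_distrib_right atLeast0AtMost intro!: sum.cong)
    finally show ?thesis by simp
  qed
  have 1: "(\<lambda>w. (A w - ?p a w) * B w) \<in> O[F](\<lambda>w. x w ^ Suc n * 1)"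
    using A unfolding expands_def
    by (intro landau_o.big.mult expands_bigo_1[OF B x]) auto
  have 2: "(\<lambda>w. ?p a w * (B w - ?p b w)) \<in> O[F](\<lambda>w. 1 * x w ^ Suc n)"
    using B unfolding expands_def
    by (intro landau_o.big.mult expands_poly_bigo_1[OF A x]) auto
  have 3: "(\<lambda>w. \<Sum>(i,j)\<in>?R. fps_nth (a w) i * fps_nth (b w) j * x w ^ (i + j))
      \<in> O[F](\<lambda>w. x w ^ Suc n)"
  proof (rule big_sum_in_bigo)
    fix ij assume *: "ij \<in> ?R"
    obtain i j where [simp]: "ij = (i, j)" by (cases ij)
    have "(\<lambda>w. fps_nth (a w) i * fps_nth (b w) j * x w ^ (i + j)) \<in> O[F](\<lambda>w. 1 * x w ^ Suc n)"
      using * by (intro landau_o.big.mult ab power_bigo_power x) auto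
    then show "(\<lambda>w. case ij of (i, j) \<Rightarrow> fps_nth (a w) i * fps_nth (b w) j * x w ^ (i + j))
        \<in> O[F](\<lambda>w. x w ^ Suc n)" by simp
  qed
  have "(\<lambda>w. (A w - ?p a w) * B w + ?p a w * (B w - ?p b w)
         + (\<Sum>(i,j)\<in>?R. fps_nth (a w) i * fps_nth (b w) j * x w ^ (i + j))) \<in> O[F](\<lambda>w. x w ^ Suc n)"
    using 1 2 3 by (auto intro!: sum_in_bigo(1))
  also have "(\<lambda>w. (A w - ?p a w) * B w + ?p a w * (B w - ?p b w)
         + (\<Sum>(i,j)\<in>?R. fps_nth (a w) i * fps_nth (b w) j * x w ^ (i + j)))
     = (\<lambda>w. A w * B w - ?p (\<lambda>w. a w * b w) w)"
    unfolding prod[symmetric] by (simp add: algebra_simps fun_eq_iff)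
  finally have "(\<lambda>w. A w * B w - ?p (\<lambda>w. a w * b w) w) \<in> O[F](\<lambda>w. x w ^ Suc n)" .
  moreover have "(\<lambda>w. fps_nth (a w * b w) k) \<in> O[F](\<lambda>_. 1)" if "k \<le> n" for k
    unfolding fps_mult_nth using that by (intro big_sum_in_bigo ab) auto
  ultimately show ?thesis unfolding expands_def by blast
qed

lemma expands_polynomial:
  assumes x: "x \<in> O[F](\<lambda>_. 1)" and "n \<le> m"
    and A: "\<forall>\<^sub>F w in F. A w = (\<Sum>k\<le>m. fps_nth (a w) k * x w ^ k)"
    and a: "\<And>k. k \<le> m \<Longrightarrow> (\<lambda>w. fps_nth (a w) k) \<in> O[F](\<lambda>_. 1)"
  shows "expands F x n A a"
proof -
  have "(\<lambda>w. \<Sum>k\<in>{Suc n..m}. fps_nth (a w) k * x w ^ k) \<in> O[F](\<lambda>w. x w ^ Suc n)"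
  proof (rule big_sum_in_bigo)
    fix k assume "k \<in> {Suc n..m}"
    then have "(\<lambda>w. fps_nth (a w) k * x w ^ k) \<in> O[F](\<lambda>w. 1 * x w ^ Suc n)"
      by (intro landau_o.big.mult a power_bigo_power x) auto
    then show "(\<lambda>w. fps_nth (a w) k * x w ^ k) \<in> O[F](\<lambda>w. x w ^ Suc n)" by simp
  qed
  moreover have "\<forall>\<^sub>F w in F. (\<Sum>k\<in>{Suc n..m}. fps_nth (a w) k * x w ^ k)
     = A w - (\<Sum>k\<le>n. fps_nth (a w) k * x w ^ k)"
    using A
  proof eventually_elim
    case (elim w)
    have "{..m} = {..n} \<union> {Suc n..m}" using \<open>n \<le> m\<close> by auto
    with elim show ?case by (simp add: sum.union_disjoint)
  qed
  ultimately show ?thesis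
    using a \<open>n \<le> m\<close> unfolding expands_def by (auto simp: landau_o.big.in_cong)
qed

lemma expands_fps_X_power:
  assumes "x \<in> O[F](\<lambda>_. 1)"
  shows "expands F x n (\<lambda>w. x w ^ j) (\<lambda>_. fps_X ^ j)"
\<comment> \<open>The polynomial must be read as one of degree at least \<open>n\<close>, also when
  \<open>j < n\<close>.\<close>
proof (rule expands_polynomial[of x F n "max n j"])
  show "\<forall>\<^sub>F w in F. x w ^ j = (\<Sum>k\<le>max n j. fps_nth (fps_X ^ j) k * x w ^ k)"
    by (intro always_eventually allI) (simp add: fps_X_power_nth if_distrib[of "\<lambda>c. c * _"] cong: if_cong)
qed (use assms in auto)

text \<open>Division costs one order: a remainder \<open>x ^ (n + 2)\<close> becomes
  \<open>x ^ (n + 1)\<close>. It serves for the factor \<open>1 / x\<close> that \<open>Fres\<close>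
  acquires from the scaling of \<open>R\<close>.\<close>

lemma expands_divide:
  assumes "expands F x (Suc n) A a" "\<forall>\<^sub>F w in F. x w \<noteq> 0" "\<forall>\<^sub>F w in F. fps_nth (a w) 0 = 0"
  shows "expands F x n (\<lambda>w. A w / x w) (\<lambda>w. fps_shift 1 (a w))"
proof -
  have "(\<lambda>w. (A w - (\<Sum>k\<le>Suc n. fps_nth (a w) k * x w ^ k)) / x w) \<in> O[F](\<lambda>w. x w ^ Suc (Suc n) / x w)"
    using assms(1,2) unfolding expands_def by (intro landau_o.big.divide_right) auto
  moreover have "\<forall>\<^sub>F w in F. x w ^ Suc (Suc n) / x w = x w ^ Suc n"
    using assms(2) by eventually_elim simp
  moreover have "\<forall>\<^sub>F w in F. (A w - (\<Sum>k\<le>Suc n. fps_nth (a w) k * x w ^ k)) / x w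
     = A w / x w - (\<Sum>k\<le>n. fps_nth (fps_shift 1 (a w)) k * x w ^ k)"
    using assms(2,3)
    by eventually_elim (simp add: sum.atMost_Suc_shift diff_divide_distrib sum_divide_distrib del: sum.atMost_Suc)
  ultimately have "(\<lambda>w. A w / x w - (\<Sum>k\<le>n. fps_nth (fps_shift 1 (a w)) k * x w ^ k))
      \<in> O[F](\<lambda>w. x w ^ Suc n)"
    by (simp add: landau_o.big.in_cong landau_o.big.cong)
  then show ?thesis using assms(1) unfolding expands_def by auto
qed

lemma expands_bigo_error:
  assumes "expands F x n A a" "(\<lambda>w. B w - A w) \<in> O[F](\<lambda>w. x w ^ Suc n)"
  shows "expands F x n B a"
  using assms sum_in_bigo(1)[OF assms(2), of "\<lambda>w. A w - (\<Sum>k\<le>n. fps_nth (a w) k * x w ^ k)"]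
  unfolding expands_def by (auto simp: algebra_simps)

text \<open>The Lagrange remainder is \<open>(x * R) ^ (n + 1)\<close> times a derivative at an
  intermediate point. Since \<open>h w\<close> varies with \<open>w\<close>, the derivatives are
  bounded on a fixed ball around \<open>c\<close>, eventually uniformly in \<open>w\<close>;
  boundedness of \<open>R\<close> does the rest.\<close>

lemma expands_Taylor:
  fixes h :: "'c \<Rightarrow> real \<Rightarrow> real" and R :: "'c \<Rightarrow> real"
  assumes x: "(x \<longlongrightarrow> 0) F" and R: "R \<in> O[F](\<lambda>_. 1)" and "\<delta> > 0"
    and D: "\<forall>\<^sub>F w in F. \<forall>i r. \<bar>r - c\<bar> \<le> \<delta> \<longrightarrow>
       ((deriv ^^ i) (h w) has_real_derivative (deriv ^^ Suc i) (h w) r) (at r)"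
    and bd: "\<And>i. \<exists>C. \<forall>\<^sub>F w in F. \<forall>r. \<bar>r - c\<bar> \<le> \<delta> \<longrightarrow> \<bar>(deriv ^^ i) (h w) r\<bar> \<le> C"
  shows "expands F x n (\<lambda>w. h w (c + x w * R w))
           (\<lambda>w. Abs_fps (\<lambda>i. (deriv ^^ i) (h w) c * R w ^ i / fact i))"
proof -
  have x1: "x \<in> O[F](\<lambda>_. 1)" using x by (intro bigoI_tendsto[where c=0]) auto
  have Rp: "(\<lambda>w. R w ^ i) \<in> O[F](\<lambda>_. 1)" for i
    using landau_o.big_power[OF R, of i] by simp
  from R obtain M where M: "\<forall>\<^sub>F w in F. \<bar>R w\<bar> \<le> M" by (auto elim!: landau_o.bigE)
  have "((\<lambda>w. x w * M) \<longlongrightarrow> 0 * M) F" by (intro tendsto_intros x)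
  then have "\<forall>\<^sub>F w in F. dist (x w * M) 0 < \<delta>" using \<open>\<delta> > 0\<close> by (intro tendstoD) auto
  then have small: "\<forall>\<^sub>F w in F. \<bar>x w * R w\<bar> \<le> \<delta>"
    using M
  proof eventually_elim
    case (elim w)
    have "\<bar>x w * R w\<bar> \<le> \<bar>x w\<bar> * M" using elim by (auto simp: abs_mult intro: mult_left_mono)
    also have "\<dots> \<le> \<bar>x w * M\<bar>" by (simp add: abs_mult mult_left_mono)
    finally show ?case using elim by simp
  qed
  obtain C where C: "\<forall>\<^sub>F w in F. \<forall>r. \<bar>r - c\<bar> \<le> \<delta> \<longrightarrow> \<bar>(deriv ^^ Suc n) (h w) r\<bar> \<le> C"
    using bd by blast
  have coeff: "(\<lambda>w. (deriv ^^ i) (h w) c * R w ^ i / fact i) \<in> O[F](\<lambda>_. 1)" for i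
  proof -
    obtain C where C: "\<forall>\<^sub>F w in F. \<forall>r. \<bar>r - c\<bar> \<le> \<delta> \<longrightarrow> \<bar>(deriv ^^ i) (h w) r\<bar> \<le> C"
      using bd by blast
    have "(\<lambda>w. (deriv ^^ i) (h w) c) \<in> O[F](\<lambda>_. 1)"
      by (intro bigoI[of _ C] eventually_mono[OF C]) (use \<open>\<delta> > 0\<close> in auto)
    from landau_o.big.mult[OF this Rp[of i]]
    show ?thesis by simp
  qed
  have "(\<lambda>w. h w (c + x w * R w) - (\<Sum>k\<le>n. (deriv ^^ k) (h w) c * R w ^ k / fact k * x w ^ k))
     \<in> O[F](\<lambda>w. R w ^ Suc n * x w ^ Suc n)"
  proof (rule bigoI[of _ "C / fact (Suc n)"])
    show "\<forall>\<^sub>F w in F. norm (h w (c + x w * R w)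
        - (\<Sum>k\<le>n. (deriv ^^ k) (h w) c * R w ^ k / fact k * x w ^ k))
      \<le> C / fact (Suc n) * norm (R w ^ Suc n * x w ^ Suc n)"
      using small D C
    proof eventually_elim
      case (elim w)
      let ?y = "x w * R w"
      have C0: "C \<ge> 0" using elim(3)[rule_format, of c] \<open>\<delta> > 0\<close> by simp
      have sum_eq: "(\<Sum>k\<le>n. (deriv ^^ k) (h w) c * R w ^ k / fact k * x w ^ k)
         = (\<Sum>k<Suc n. (deriv ^^ k) (h w) c / fact k * ?y ^ k)"
        by (simp add: lessThan_Suc_atMost power_mult_distrib mult_ac)
      show ?case
      \<comment> \<open>The Lagrange form \<open>Taylor\<close> requires a point different from the
        centre, so a zero increment is treated separately.\<close>
      proof (cases "?y = 0")
        case True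
        have "(\<Sum>k<Suc n. (deriv ^^ k) (h w) c / fact k * ?y ^ k) = h w c"
          unfolding True by (simp add: sum.lessThan_Suc_shift del: sum.lessThan_Suc)
        with sum_eq True C0 show ?thesis by auto
      next
        case False
        have d: "\<forall>m t. m < Suc n \<and> c - \<delta> \<le> t \<and> t \<le> c + \<delta> \<longrightarrow>
            ((deriv ^^ m) (h w) has_real_derivative (deriv ^^ Suc m) (h w) t) (at t)"
          using elim(2) by (simp only: abs_le_iff) (simp add: algebra_simps)
        have "\<exists>t. (if c + ?y < c then c + ?y < t \<and> t < c else c < t \<and> t < c + ?y) \<and>
          h w (c + ?y) = (\<Sum>m<Suc n. ((deriv ^^ m) (h w) c / fact m) * (c + ?y - c)^m)
            + ((deriv ^^ Suc n) (h w) t / fact (Suc n)) * (c + ?y - c)^Suc n"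
          by (rule Taylor[of _ "\<lambda>i. (deriv ^^ i) (h w)" "h w" "c - \<delta>" "c + \<delta>"])
             (use elim(1) False \<open>\<delta> > 0\<close> d in \<open>auto simp only: abs_le_iff funpow_0\<close>)
        then obtain t where t: "if c + ?y < c then c + ?y < t \<and> t < c else c < t \<and> t < c + ?y"
          "h w (c + ?y) = (\<Sum>m<Suc n. ((deriv ^^ m) (h w) c / fact m) * (c + ?y - c)^m)
            + ((deriv ^^ Suc n) (h w) t / fact (Suc n)) * (c + ?y - c)^Suc n" by blast
        then have "\<bar>t - c\<bar> \<le> \<delta>" using elim(1) by (auto split: if_splits)
        then have "\<bar>(deriv ^^ Suc n) (h w) t\<bar> \<le> C" using elim(3) by blast
        then have "\<bar>(deriv ^^ Suc n) (h w) t / fact (Suc n) * ?y ^ Suc n\<bar> \<le> C / fact (Suc n) * \<bar>?y ^ Suc n\<bar>"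
          unfolding abs_mult by (intro mult_right_mono) (auto simp: divide_right_mono simp del: fact_Suc)
        moreover have "h w (c + ?y) - (\<Sum>k<Suc n. (deriv ^^ k) (h w) c / fact k * ?y ^ k)
            = (deriv ^^ Suc n) (h w) t / fact (Suc n) * ?y ^ Suc n"
          using t(2) by (simp del: sum.lessThan_Suc power_Suc fact_Suc)
        ultimately show ?thesis
          unfolding sum_eq by (simp only: real_norm_def power_mult_distrib mult.commute)
      qed
    qed
  qed
  also have "(\<lambda>w. R w ^ Suc n * x w ^ Suc n) \<in> O[F](\<lambda>w. 1 * x w ^ Suc n)"
    by (intro landau_o.big.mult Rp) auto
  finally show ?thesis using coeff by (simp add: expands_def)
qed

section \<open>Bounds from compactness and periodicity\<close>

lemma continuous_on_compact_bound:
  fixes g :: "'a::topological_space \<Rightarrow> real"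
  assumes "continuous_on K g" "compact K"
  obtains C where "\<And>z. z \<in> K \<Longrightarrow> \<bar>g z\<bar> \<le> C"
  using compact_imp_bounded[OF compact_continuous_image[OF assms]] that
  unfolding bounded_iff by (metis imageI real_norm_def)

text \<open>The phase is unbounded in time, so compactness applies only after the last argument has
  been moved into one period; the other two eventually lie in a fixed box.\<close>

lemma periodic_function_bounded:
  fixes g :: "real \<times> real \<times> real \<Rightarrow> real"
  assumes g: "continuous_on UNIV g" and per: "\<And>a b s. g (a, b, s + T) = g (a, b, s)" and "T > 0"
    and bd: "a \<in> O[F](\<lambda>_. 1)" "b \<in> O[F](\<lambda>_. 1)"
  shows "(\<lambda>w. g (a w, b w, s w)) \<in> O[F](\<lambda>_. 1)"
proof -
  obtain A B where A: "\<forall>\<^sub>F w in F. \<bar>a w\<bar> \<le> A" and B: "\<forall>\<^sub>F w in F. \<bar>b w\<bar> \<le> B"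
    using bd by (auto elim!: landau_o.bigE)
  obtain C where C: "\<And>z. z \<in> {-A..A} \<times> {-B..B} \<times> {0..T} \<Longrightarrow> \<bar>g z\<bar> \<le> C"
    by (rule continuous_on_compact_bound[of "{-A..A} \<times> {-B..B} \<times> {0..T}" g])
       (auto intro: compact_Times continuous_on_subset[OF g])
  show ?thesis
  proof (rule bigoI[of _ C])
    show "\<forall>\<^sub>F w in F. norm (g (a w, b w, s w)) \<le> C * norm (1::real)"
      using A B
    proof eventually_elim
      case (elim w)
      obtain s0 where "s0 \<in> {0..T}" "g (a w, b w, s0) = g (a w, b w, s w)"
        using periodic_representative[of "\<lambda>s. g (a w, b w, s)" T "s w"] per \<open>T > 0\<close> by metis
      with elim C[of "(a w, b w, s0)"] show ?case by (simp add: abs_le_iff)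
    qed
  qed
qed

lemma smooth_on_partials:
  assumes "smooth_on UNIV (\<lambda>(a, b, s). w a b s)"
  shows "(\<lambda>a'. w a' b s) field_differentiable at a"
    and "(\<lambda>b'. w a b' s) field_differentiable at b"
    and "(\<lambda>s'. w a b s') field_differentiable at s"
  using smooth_on_higher_partial_differentiable[OF assms, where i=0 and e="(1,0,0)" and p="(0,b,s)" and r=a]
    smooth_on_higher_partial_differentiable[OF assms, where i=0 and e="(0,1,0)" and p="(a,0,s)" and r=b]
    smooth_on_higher_partial_differentiable[OF assms, where i=0 and e="(0,0,1)" and p="(a,b,0)" and r=s]
  by (auto simp: field_differentiable_def Basis_prod_def zero_prod_def)

text \<open>No differentiability is involved: the same numbers are derivatives at both points, so
  the choice inside \<open>deriv\<close> gives the same value.\<close>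

lemma deriv_periodic:
  fixes f :: "real \<Rightarrow> real"
  assumes "\<And>s. f (s + T) = f s"
  shows "deriv f (s + T) = deriv f s"
proof -
  have "(f has_field_derivative D) (at (s + T)) \<longleftrightarrow> (f has_field_derivative D) (at s)" for D
    using DERIV_shift[of f D s T] assms by simp
  then show ?thesis by (simp add: deriv_def)
qed

lemma periodic_partials_bounded:
  assumes sm: "smooth_on UNIV (\<lambda>(a, b, s). w a b s)"
    and per: "\<And>a b s. w a b (s + T) = w a b s" and "T > 0"
    and bd: "a \<in> O[F](\<lambda>_. 1)" "b \<in> O[F](\<lambda>_. 1)"
  shows "(\<lambda>t. w (a t) (b t) (s t)) \<in> O[F](\<lambda>_. 1)"
    and "(\<lambda>t. deriv (\<lambda>a'. w a' (b t) (s t)) (a t)) \<in> O[F](\<lambda>_. 1)"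
    and "(\<lambda>t. deriv (\<lambda>b'. w (a t) b' (s t)) (b t)) \<in> O[F](\<lambda>_. 1)"
    and "(\<lambda>t. deriv (\<lambda>s'. w (a t) (b t) s') (s t)) \<in> O[F](\<lambda>_. 1)"
proof -
  have Basis: "(1, 0, 0) \<in> (Basis :: (real \<times> real \<times> real) set)"
     "(0, 1, 0) \<in> (Basis :: (real \<times> real \<times> real) set)"
     "(0, 0, 1) \<in> (Basis :: (real \<times> real \<times> real) set)"
    by (auto simp: Basis_prod_def zero_prod_def)
  have "continuous_on UNIV (\<lambda>(a, b, s). w a b s)"
    using sm by (auto simp: smooth_on_def intro: Ck_on_continuous)
  from periodic_function_bounded[OF this _ \<open>T > 0\<close> bd, of s] per
  show "(\<lambda>t. w (a t) (b t) (s t)) \<in> O[F](\<lambda>_. 1)" by simp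
  obtain g where g: "continuous_on UNIV g"
    "\<And>p r. p + r *\<^sub>R (1,0,0) \<in> interior UNIV \<Longrightarrow>
       (deriv ^^ 1) (\<lambda>r. (\<lambda>(a, b, s). w a b s) (p + r *\<^sub>R (1,0,0))) r = g (p + r *\<^sub>R (1,0,0))"
    using smooth_on_higher_partial[OF sm Basis(1), of 1] by metis
  have eq: "deriv (\<lambda>a'. w a' b s) a = g (a, b, s)" for a b s
    using g(2)[of "(0,b,s)" a] by simp
  from periodic_function_bounded[OF g(1) _ \<open>T > 0\<close> bd, of s]
  show "(\<lambda>t. deriv (\<lambda>a'. w a' (b t) (s t)) (a t)) \<in> O[F](\<lambda>_. 1)"
    by (simp add: eq[symmetric] per)
  obtain g where g: "continuous_on UNIV g"
    "\<And>p r. p + r *\<^sub>R (0,1,0) \<in> interior UNIV \<Longrightarrow>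
       (deriv ^^ 1) (\<lambda>r. (\<lambda>(a, b, s). w a b s) (p + r *\<^sub>R (0,1,0))) r = g (p + r *\<^sub>R (0,1,0))"
    using smooth_on_higher_partial[OF sm Basis(2), of 1] by metis
  have eq: "deriv (\<lambda>b'. w a b' s) b = g (a, b, s)" for a b s
    using g(2)[of "(a,0,s)" b] by simp
  from periodic_function_bounded[OF g(1) _ \<open>T > 0\<close> bd, of s]
  show "(\<lambda>t. deriv (\<lambda>b'. w (a t) b' (s t)) (b t)) \<in> O[F](\<lambda>_. 1)"
    by (simp add: eq[symmetric] per)
  obtain g where g: "continuous_on UNIV g"
    "\<And>p r. p + r *\<^sub>R (0,0,1) \<in> interior UNIV \<Longrightarrow>
       (deriv ^^ 1) (\<lambda>r. (\<lambda>(a, b, s). w a b s) (p + r *\<^sub>R (0,0,1))) r = g (p + r *\<^sub>R (0,0,1))"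
    using smooth_on_higher_partial[OF sm Basis(3), of 1] by metis
  have eq: "deriv (\<lambda>s'. w a b s') s = g (a, b, s)" for a b s
    using g(2)[of "(a,b,0)" s] by simp
  from periodic_function_bounded[OF g(1) _ \<open>T > 0\<close> bd, of s]
  show "(\<lambda>t. deriv (\<lambda>s'. w (a t) (b t) s') (s t)) \<in> O[F](\<lambda>_. 1)"
    by (simp add: eq[symmetric] deriv_periodic per)
qed

lemma strip_interior:
  "interior ({-a..a::real} \<times> (UNIV::real set) \<times> (UNIV::real set)) = {-a<..<a} \<times> UNIV \<times> UNIV"
  by (simp add: interior_Times)

lemma admissible_coeff_differentiable:
  assumes "admissible_perturbation \<rho>max q h hc" "1 \<le> j" "\<bar>r\<bar> < \<rho>max"
  shows "((deriv ^^ i) (\<lambda>r. hc j r \<phi> S) has_real_derivative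
           (deriv ^^ Suc i) (\<lambda>r. hc j r \<phi> S) r) (at r)"
proof -
  have sm: "smooth_on ({-\<rho>max..\<rho>max} \<times> UNIV \<times> UNIV) (\<lambda>(r, \<phi>, S). hc j r \<phi> S)"
    using assms unfolding admissible_perturbation_def by blast
  from smooth_on_higher_partial_differentiable[OF this, where i=i and e="(1,0,0)" and p="(0,\<phi>,S)" and r=r]
  show ?thesis using assms(3) unfolding strip_interior
    by (auto simp: Basis_prod_def zero_prod_def abs_less_iff)
qed

text \<open>The strict inequality \<open>b < \<rho>max\<close> keeps \<open>r\<close> in the
  interior, where the two-sided iterated derivative coincides with a function continuous on the
  whole closed strip. Periodicity reduces both angles to a compact square.\<close>

lemma admissible_coeff_bounded:
  assumes adm: "admissible_perturbation \<rho>max q h hc" and j: "1 \<le> j" and b: "b < \<rho>max"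
  shows "\<exists>C. \<forall>r \<phi> S. \<bar>r\<bar> \<le> b \<longrightarrow> \<bar>(deriv ^^ i) (\<lambda>r. hc j r \<phi> S) r\<bar> \<le> C"
proof -
  have sm: "smooth_on ({-\<rho>max..\<rho>max} \<times> UNIV \<times> UNIV) (\<lambda>(r, \<phi>, S). hc j r \<phi> S)"
    and per: "\<And>r \<phi> S. \<bar>r\<bar> \<le> \<rho>max \<Longrightarrow> hc j r (\<phi> + 2 * pi) S = hc j r \<phi> S"
       "\<And>r \<phi> S. \<bar>r\<bar> \<le> \<rho>max \<Longrightarrow> hc j r \<phi> (S + 2 * pi) = hc j r \<phi> S"
    using adm j unfolding admissible_perturbation_def by blast+
  have Basis: "(1, 0, 0) \<in> (Basis :: (real \<times> real \<times> real) set)"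
    by (auto simp: Basis_prod_def zero_prod_def)
  obtain g where g: "continuous_on ({-\<rho>max..\<rho>max} \<times> UNIV \<times> UNIV) g"
    "\<And>p r. p + r *\<^sub>R (1,0,0) \<in> {-\<rho>max<..<\<rho>max} \<times> UNIV \<times> UNIV \<Longrightarrow>
       (deriv ^^ i) (\<lambda>r. (\<lambda>(r, \<phi>, S). hc j r \<phi> S) (p + r *\<^sub>R (1,0,0))) r = g (p + r *\<^sub>R (1,0,0))"
    using smooth_on_higher_partial[OF sm Basis, of i] unfolding strip_interior by metis
  have eq: "(deriv ^^ i) (\<lambda>r. hc j r \<phi> S) r = g (r, \<phi>, S)" if "\<bar>r\<bar> < \<rho>max" for r \<phi> S
    using g(2)[of "(0,\<phi>,S)" r] that by (simp add: abs_less_iff)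
  have "{-b..b} \<times> {0..2*pi} \<times> {0..2*pi} \<subseteq> {-\<rho>max..\<rho>max} \<times> UNIV \<times> UNIV"
    using b by auto
  from continuous_on_subset[OF g(1) this]
  obtain C where C: "\<And>z. z \<in> {-b..b} \<times> {0..2*pi} \<times> {0..2*pi} \<Longrightarrow> \<bar>g z\<bar> \<le> C"
    by (rule continuous_on_compact_bound) (auto intro: compact_Times)
  have "\<bar>(deriv ^^ i) (\<lambda>r. hc j r \<phi> S) r\<bar> \<le> C" if r: "\<bar>r\<bar> \<le> b" for r \<phi> S
  proof -
    \<comment> \<open>The values of \<open>H\<close> are whole functions of \<open>r\<close>, so the
      reduced angles do not depend on \<open>r\<close> and the equality survives differentiation in
      \<open>r\<close>. The cut-off is there because periodicity is known only on the strip.\<close>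
    define H where "H \<phi> S = (\<lambda>r. if \<bar>r\<bar> \<le> \<rho>max then hc j r \<phi> S else 0)" for \<phi> S
    obtain \<phi>0 where \<phi>0: "\<phi>0 \<in> {0..2*pi}" "H \<phi>0 S = H \<phi> S"
      by (rule periodic_representative[of "\<lambda>\<phi>. H \<phi> S" "2*pi" \<phi>]) (auto simp: H_def per)
    obtain S0 where S0: "S0 \<in> {0..2*pi}" "H \<phi>0 S0 = H \<phi>0 S"
      by (rule periodic_representative[of "\<lambda>S. H \<phi>0 S" "2*pi" S]) (auto simp: H_def per)
    have "\<forall>\<^sub>F y in nhds r. y \<in> {-\<rho>max<..<\<rho>max}"
      using r b by (intro eventually_nhds_in_open) auto
    then have "\<forall>\<^sub>F y in nhds r. hc j y \<phi> S = hc j y \<phi>0 S0"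
    proof eventually_elim
      case (elim y)
      then have "\<bar>y\<bar> \<le> \<rho>max" by auto
      then show ?case using fun_cong[OF \<phi>0(2), of y] fun_cong[OF S0(2), of y] by (simp add: H_def)
    qed
    then have "(deriv ^^ i) (\<lambda>r. hc j r \<phi> S) r = (deriv ^^ i) (\<lambda>r. hc j r \<phi>0 S0) r"
      by (rule higher_deriv_cong_ev) simp
    also have "\<dots> = g (r, \<phi>0, S0)" using eq r b by simp
    finally show ?thesis using C[of "(r, \<phi>0, S0)"] \<phi>0 S0 r by (simp add: abs_le_iff)
  qed
  then show ?thesis by blast
qed

lemma expands_const:
  assumes "A \<in> O[F](\<lambda>_. 1)" "x \<in> O[F](\<lambda>_. 1)"
  shows "expands F x n A (\<lambda>w. fps_const (A w))"
proof (rule expands_polynomial[of x F n n])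
  show "\<forall>\<^sub>F w in F. A w = (\<Sum>k\<le>n. fps_nth (fps_const (A w)) k * x w ^ k)"
    by (simp add: if_distrib[of "\<lambda>c. c * _"] cong: if_cong)
  fix k assume "k \<le> n"
  show "(\<lambda>w. fps_nth (fps_const (A w)) k) \<in> O[F](\<lambda>_. 1)"
    using assms(1) by (cases "k = 0") auto
qed (use assms in auto)

section \<open>Expansions along bounded functions of time\<close>

text \<open>\<open>R\<close> and \<open>\<Psi>\<close> are any functions bounded near infinity, not
  assumed continuous and not assumed to solve an equation. They will be the components of the
  inverse image of a solution, about which only a bound is established.\<close>

locale trajectory =
  fixes P :: perturbed_data and R \<Psi> :: "real \<Rightarrow> real"
  assumes sys: "perturbed_system P"
    and R: "R \<in> O[at_top](\<lambda>_. 1)" and \<Psi>: "\<Psi> \<in> O[at_top](\<lambda>_. 1)"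
begin

definition "x t = t powr (- 1 / (2 * real (qq P)))"

lemma qq_pos: "qq P > 0"
  using sys unfolding perturbed_system_def by auto

lemma x_tendsto: "(x \<longlongrightarrow> 0) at_top"
  unfolding x_def using qq_pos by (intro tendsto_neg_powr filterlim_ident) (auto simp: field_simps)

lemma x_bigo: "x \<in> O[at_top](\<lambda>_. 1)"
  using x_tendsto by (intro bigoI_tendsto[where c=0]) auto

lemma x_pos: "t > 0 \<Longrightarrow> x t > 0"
  by (simp add: x_def)

lemma powr_eq_x_power: "t > 0 \<Longrightarrow> t powr (- (real k / (2 * real (qq P)))) = x t ^ k"
  by (simp add: x_def powr_powr flip: powr_realpow)

lemma powr_eq_x_power2: "t > 0 \<Longrightarrow> t powr (- (real j / real (qq P))) = x t ^ (2 * j)"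
  using powr_eq_x_power[of t "2 * j"] by simp

lemma inverse_eq_x_power: "t > 0 \<Longrightarrow> 1 / t = x t ^ (2 * qq P)"
  using powr_eq_x_power[of t "2 * qq P"] qq_pos by (simp add: powr_minus_divide)

lemma powr_eq_inverse_x: "t > 0 \<Longrightarrow> t powr (1 / (2 * real (qq P))) = 1 / x t"
  by (simp add: x_def powr_minus_divide)

lemma deriv_phase:
  assumes t: "t > 0"
  shows "deriv (phase P) t = (\<Sum>k\<le>2 * qq P. dphase_coeff P k * x t ^ k)"
proof -
  let ?c = "\<lambda>j. ph P j * (1 - real j / real (qq P) + (if j = qq P then 1 else 0)) * x t ^ (2 * j)"
  have "(phase P has_real_derivative (ph P 0 +
     (\<Sum>j\<in>{1..<qq P}. ph P j * ((1 - real j / real (qq P)) * t powr (- (real j / real (qq P)))))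
     + ph P (qq P) * (1 / t))) (at t)"
    unfolding phase_def[abs_def] using t
    by (auto intro!: derivative_eq_intros DERIV_sum sum.cong)
  then have "deriv (phase P) t = ph P 0 +
     (\<Sum>j\<in>{1..<qq P}. ph P j * ((1 - real j / real (qq P)) * t powr (- (real j / real (qq P)))))
     + ph P (qq P) * (1 / t)"
    by (rule DERIV_imp_deriv)
  \<comment> \<open>At \<open>j = qq P\<close> the bracket in \<open>?c\<close> is
    \<open>1 - 1 + 1\<close>, the coefficient of \<open>1 / t = x t ^ (2 * qq P)\<close> coming from
    the logarithm; this is the purpose of the Kronecker term.\<close>
  also have "\<dots> = ?c 0 + (\<Sum>j\<in>{1..<qq P}. ?c j) + ?c (qq P)"
    using qq_pos inverse_eq_x_power[OF t] powr_eq_x_power2[OF t] by (simp add: mult.assoc)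
  also have "\<dots> = (\<Sum>j\<le>qq P. ?c j)"
  proof -
    have "{..qq P} = insert 0 (insert (qq P) {1..<qq P})" using qq_pos by auto
    then show ?thesis using qq_pos by simp
  qed
  also have "\<dots> = (\<Sum>k\<in>(\<lambda>j. 2 * j) ` {..qq P}. dphase_coeff P k * x t ^ k)"
    by (subst sum.reindex) (auto simp: inj_on_def dphase_coeff_def intro!: sum.cong)
  also have "\<dots> = (\<Sum>k\<le>2 * qq P. dphase_coeff P k * x t ^ k)"
    by (rule sum.mono_neutral_left) (auto simp: dphase_coeff_def elim!: evenE)
  finally show ?thesis .
qed

lemma res_margin:
  obtains \<delta> where "\<delta> > 0" "\<bar>res P\<bar> + \<delta> < rad P"
    "\<forall>\<^sub>F t in at_top. \<bar>res P + x t * R t\<bar> < rad P"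
proof -
  \<comment> \<open>Half the distance to the edge: this \<open>\<delta>\<close> is later the radius
    of the Taylor ball, and it also absorbs the vanishing displacement
    \<open>x t * R t\<close>.\<close>
  define \<delta> where "\<delta> = (rad P - \<bar>res P\<bar>) / 2"
  have \<delta>: "\<delta> > 0" "\<bar>res P\<bar> + \<delta> < rad P"
    using sys unfolding perturbed_system_def \<delta>_def by (auto simp: field_simps)
  from R obtain M where M: "\<forall>\<^sub>F t in at_top. \<bar>R t\<bar> \<le> M" by (auto elim!: landau_o.bigE)
  have "((\<lambda>t. x t * M) \<longlongrightarrow> 0 * M) at_top" by (intro tendsto_intros x_tendsto)
  then have "\<forall>\<^sub>F t in at_top. dist (x t * M) 0 < \<delta>" using \<delta> by (intro tendstoD) auto
  then have "\<forall>\<^sub>F t in at_top. \<bar>res P + x t * R t\<bar> < rad P"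
    using M
  proof eventually_elim
    case (elim t)
    have "\<bar>x t * R t\<bar> \<le> \<bar>x t\<bar> * M" using elim by (auto simp: abs_mult intro: mult_left_mono)
    also have "\<dots> \<le> \<bar>x t * M\<bar>" by (simp add: abs_mult mult_left_mono)
    finally show ?case using elim \<delta> by simp
  qed
  with \<delta> show ?thesis using that by blast
qed

lemma freq_expands:
  "expands at_top x n (\<lambda>t. freq P (res P + x t * R t))
     (\<lambda>t. Abs_fps (\<lambda>i. (deriv ^^ i) (freq P) (res P) * R t ^ i / fact i))"
proof -
  obtain \<delta> where \<delta>: "\<delta> > 0" "\<bar>res P\<bar> + \<delta> < rad P" by (rule res_margin)
  have sm: "smooth_on {-rad P..rad P} (freq P)"
    using sys unfolding perturbed_system_def by blast
  show ?thesis
  proof (rule expands_Taylor[OF x_tendsto R \<delta>(1), of "res P" "\<lambda>_. freq P"])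
    have "((deriv ^^ i) (freq P) has_real_derivative (deriv ^^ Suc i) (freq P) r) (at r)"
      if "\<bar>r - res P\<bar> \<le> \<delta>" for i r
      using smooth_on_higher_partial_differentiable[OF sm, where e=1 and p=0 and i=i and r=r]
        that \<delta> by (auto simp: abs_le_iff abs_less_iff abs_if split: if_splits)
    then show "\<forall>\<^sub>F w in at_top. \<forall>i r. \<bar>r - res P\<bar> \<le> \<delta> \<longrightarrow>
      ((deriv ^^ i) (freq P) has_real_derivative (deriv ^^ Suc i) (freq P) r) (at r)"
      by (intro always_eventually) blast
    fix i
    obtain g where g: "continuous_on {-rad P..rad P} g"
      "\<And>p r. p + r *\<^sub>R 1 \<in> interior {-rad P..rad P} \<Longrightarrow>
         (deriv ^^ i) (\<lambda>r. freq P (p + r *\<^sub>R 1)) r = g (p + r *\<^sub>R 1)"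
      using smooth_on_higher_partial[OF sm, of 1 i] by (auto simp del: interior_atLeastAtMost_real)
    have eq: "(deriv ^^ i) (freq P) r = g r" if "\<bar>r\<bar> < rad P" for r
      using g(2)[of 0 r] that by (simp add: abs_less_iff)
    have "{res P - \<delta>..res P + \<delta>} \<subseteq> {-rad P..rad P}"
      using \<delta> by auto
    from continuous_on_subset[OF g(1) this]
    obtain C where "\<And>r. r \<in> {res P - \<delta>..res P + \<delta>} \<Longrightarrow> \<bar>g r\<bar> \<le> C"
      by (rule continuous_on_compact_bound) auto
    then have "\<bar>(deriv ^^ i) (freq P) r\<bar> \<le> C" if "\<bar>r - res P\<bar> \<le> \<delta>" for r
      using that \<delta> by (subst eq) (auto simp: abs_le_iff)
    then show "\<exists>C. \<forall>\<^sub>F w::real in at_top. \<forall>r. \<bar>r - res P\<bar> \<le> \<delta> \<longrightarrow> \<bar>(deriv ^^ i) (freq P) r\<bar> \<le> C"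
      by (intro exI[of _ C] always_eventually) blast
  qed
qed

text \<open>Each \<open>hc j\<close> contributes its Taylor series at \<open>res P\<close> times
  \<open>x ^ (2 * j)\<close>, because \<open>t powr (-1/q)\<close> is \<open>x ^ 2\<close>; sorting
  by \<open>i + 2 * j\<close> gives the coefficients. The angles may be arbitrary functions of time
  since the Taylor bounds are uniform in them.\<close>

lemma perturbation_expands:
  assumes adm: "admissible_perturbation (rad P) (qq P) h hc"
  shows "expands at_top x n (\<lambda>t. h (res P + x t * R t) (\<Phi> t) (S t) t)
     (\<lambda>t. Abs_fps (\<lambda>k. \<Sum>(i, j)\<in>{(i, j). i + 2 * j = k \<and> 1 \<le> j}.
          (deriv ^^ i) (\<lambda>r. hc j r (\<Phi> t) (S t)) (res P) * R t ^ i / fact i))"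
proof -
  obtain \<delta> where \<delta>: "\<delta> > 0" "\<bar>res P\<bar> + \<delta> < rad P"
    and margin: "\<forall>\<^sub>F t in at_top. \<bar>res P + x t * R t\<bar> < rad P" by (rule res_margin)
  let ?c = "\<lambda>j t. Abs_fps (\<lambda>i. (deriv ^^ i) (\<lambda>r. hc j r (\<Phi> t) (S t)) (res P) * R t ^ i / fact i)"
  have "expands at_top x n (\<lambda>t. hc j (res P + x t * R t) (\<Phi> t) (S t)) (?c j)" if j: "1 \<le> j" for j
  proof (rule expands_Taylor[OF x_tendsto R \<delta>(1), of "res P" "\<lambda>t r. hc j r (\<Phi> t) (S t)"])
    show "\<forall>\<^sub>F t in at_top. \<forall>i r. \<bar>r - res P\<bar> \<le> \<delta> \<longrightarrow>
      ((deriv ^^ i) (\<lambda>r. hc j r (\<Phi> t) (S t)) has_real_derivative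
         (deriv ^^ Suc i) (\<lambda>r. hc j r (\<Phi> t) (S t)) r) (at r)"
      using \<delta> by (intro always_eventually allI impI admissible_coeff_differentiable[OF adm j]) auto
    fix i
    obtain C where C: "\<And>r \<phi> S. \<bar>r\<bar> \<le> \<bar>res P\<bar> + \<delta> \<Longrightarrow> \<bar>(deriv ^^ i) (\<lambda>r. hc j r \<phi> S) r\<bar> \<le> C"
      using admissible_coeff_bounded[OF adm j \<delta>(2)] by blast
    show "\<exists>C. \<forall>\<^sub>F t in at_top. \<forall>r. \<bar>r - res P\<bar> \<le> \<delta> \<longrightarrow> \<bar>(deriv ^^ i) (\<lambda>r. hc j r (\<Phi> t) (S t)) r\<bar> \<le> C"
      by (intro exI[of _ C] always_eventually allI impI C) auto
  qed
  then have sum: "expands at_top x n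
      (\<lambda>t. \<Sum>j\<in>{1..<Suc n}. x t ^ (2 * j) * hc j (res P + x t * R t) (\<Phi> t) (S t))
      (\<lambda>t. \<Sum>j\<in>{1..<Suc n}. fps_X ^ (2 * j) * ?c j t)"
    by (intro expands_sum expands_mult expands_fps_X_power x_bigo) auto
  \<comment> \<open>Taking \<open>K = Suc n\<close> leaves an error of order
    \<open>x ^ (2 * n + 2)\<close>, within the required \<open>x ^ (n + 1)\<close>. Summands with
    \<open>2 * j > n\<close> do not touch the coefficients up to \<open>n\<close>.\<close>
  obtain C where C: "\<forall>\<^sub>F t in at_top. \<forall>r \<phi> S. \<bar>r\<bar> \<le> rad P \<longrightarrow>
        \<bar>h r \<phi> S t - (\<Sum>j\<in>{1..<Suc n}. t powr (- (real j / real (qq P))) * hc j r \<phi> S)\<bar>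
          \<le> C * t powr (- (real (Suc n) / real (qq P)))"
    using adm unfolding admissible_perturbation_def asymp_expansion_def
    by (elim conjE allE[where x="Suc n"]) auto
  have "(\<lambda>t. h (res P + x t * R t) (\<Phi> t) (S t) t
       - (\<Sum>j\<in>{1..<Suc n}. x t ^ (2 * j) * hc j (res P + x t * R t) (\<Phi> t) (S t)))
     \<in> O[at_top](\<lambda>t. x t ^ (2 * Suc n))"
  proof (rule bigoI[of _ C])
    show "\<forall>\<^sub>F t in at_top. norm (h (res P + x t * R t) (\<Phi> t) (S t) t
       - (\<Sum>j\<in>{1..<Suc n}. x t ^ (2 * j) * hc j (res P + x t * R t) (\<Phi> t) (S t)))
        \<le> C * norm (x t ^ (2 * Suc n))"
      using C margin eventually_gt_at_top[of 0]
    proof eventually_elim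
      case (elim t)
      have "0 \<le> x t ^ (2 * Suc n)" using x_pos[OF elim(3)] by (intro zero_le_power) simp
      then show ?case
        using elim(1)[rule_format, OF less_imp_le[OF elim(2)], of "\<Phi> t" "S t"]
        by (simp only: powr_eq_x_power2[OF elim(3)] real_norm_def abs_of_nonneg)
    qed
  qed
  also have "(\<lambda>t. x t ^ (2 * Suc n)) \<in> O[at_top](\<lambda>t. x t ^ Suc n)"
    by (intro power_bigo_power x_bigo) auto
  finally have "expands at_top x n (\<lambda>t. h (res P + x t * R t) (\<Phi> t) (S t) t)
      (\<lambda>t. \<Sum>j\<in>{1..<Suc n}. fps_X ^ (2 * j) * ?c j t)"
    by (rule expands_bigo_error[OF sum])
  then show ?thesis
  proof (rule expands_cong)
    have "fps_nth (\<Sum>j\<in>{1..<Suc n}. fps_X ^ (2 * j) * ?c j t) k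
       = (\<Sum>(i, j)\<in>{(i, j). i + 2 * j = k \<and> 1 \<le> j}.
          (deriv ^^ i) (\<lambda>r. hc j r (\<Phi> t) (S t)) (res P) * R t ^ i / fact i)" if k: "k \<le> n" for t k
    proof -
      have "fps_nth (\<Sum>j\<in>{1..<Suc n}. fps_X ^ (2 * j) * ?c j t) k
         = (\<Sum>j\<in>{1..<Suc n}. if k < 2 * j then 0 else fps_nth (?c j t) (k - 2 * j))"
        by (simp add: fps_sum_nth fps_X_power_mult_nth)
      also have "\<dots> = (\<Sum>j\<in>{j. 1 \<le> j \<and> 2 * j \<le> k}. fps_nth (?c j t) (k - 2 * j))"
        using k by (intro sum.mono_neutral_cong_right) auto
      also have "\<dots> = (\<Sum>(i, j)\<in>{(i, j). i + 2 * j = k \<and> 1 \<le> j}. fps_nth (?c j t) i)"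
        by (rule sum.reindex_bij_witness[of _ snd "\<lambda>j. (k - 2 * j, j)"]) auto
      finally show ?thesis by simp
    qed
    then show "\<forall>\<^sub>F t in at_top. \<forall>k\<le>n. fps_nth (\<Sum>j\<in>{1..<Suc n}. fps_X ^ (2 * j) * ?c j t) k
       = fps_nth (Abs_fps (\<lambda>k. \<Sum>(i, j)\<in>{(i, j). i + 2 * j = k \<and> 1 \<le> j}.
          (deriv ^^ i) (\<lambda>r. hc j r (\<Phi> t) (S t)) (res P) * R t ^ i / fact i)) k"
      by (intro always_eventually) simp
  qed auto
qed

text \<open>The factor \<open>1 / x\<close> shifts indices by one, whence
  \<open>i + 2 * j = k + 1\<close> in \<open>Fcoeff\<close>; the shift is allowed because
  \<open>1 \<le> j\<close> excludes a constant term. The summand \<open>R / (2 * q * t)\<close> is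
  \<open>x ^ (2 * q) * R / (2 * q)\<close>, the Kronecker term.\<close>

lemma Fres_expands:
  "expands at_top x n (\<lambda>t. Fres P (R t) (\<Psi> t) (phase P t) t)
     (\<lambda>t. Abs_fps (\<lambda>k. Fcoeff P k (R t) (\<Psi> t) (phase P t)))"
proof -
  let ?\<phi> = "\<lambda>t. ratio P * phase P t + \<Psi> t"
  let ?a = "\<lambda>t. Abs_fps (\<lambda>k. \<Sum>(i, j)\<in>{(i, j). i + 2 * j = k \<and> 1 \<le> j}.
          (deriv ^^ i) (\<lambda>r. force_coeff P j r (?\<phi> t) (phase P t)) (res P) * R t ^ i / fact i)"
  have adm: "admissible_perturbation (rad P) (qq P) (force P) (force_coeff P)"
    using sys unfolding perturbed_system_def by blast
  have "\<forall>\<^sub>F t in at_top. x t \<noteq> 0"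
    using eventually_gt_at_top[of 0] by eventually_elim (use x_pos in force)
  then have 1: "expands at_top x n (\<lambda>t. force P (res P + x t * R t) (?\<phi> t) (phase P t) t / x t)
     (\<lambda>t. fps_shift 1 (?a t))"
    by (intro expands_divide perturbation_expands[OF adm]) (auto intro!: always_eventually sum.neutral)
  have "(\<lambda>t. R t / (2 * real (qq P))) \<in> O[at_top](\<lambda>_. 1)"
    using R qq_pos by simp
  then have 2: "expands at_top x n (\<lambda>t. x t ^ (2 * qq P) * (R t / (2 * real (qq P))))
     (\<lambda>t. fps_X ^ (2 * qq P) * fps_const (R t / (2 * real (qq P))))"
    by (intro expands_mult expands_fps_X_power expands_const x_bigo)
  show ?thesis
  proof (rule expands_cong[OF expands_add[OF 1 2]])
    show "\<forall>\<^sub>F t in at_top. force P (res P + x t * R t) (?\<phi> t) (phase P t) t / x t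
        + x t ^ (2 * qq P) * (R t / (2 * real (qq P))) = Fres P (R t) (\<Psi> t) (phase P t) t"
      using eventually_gt_at_top[of 0]
    proof eventually_elim
      case (elim t)
      then show ?case
        unfolding Fres_def powr_eq_inverse_x[OF elim] inverse_eq_x_power[OF elim, symmetric]
        by (simp add: x_def)
    qed
    show "\<forall>\<^sub>F t in at_top. \<forall>k\<le>n. fps_nth (fps_shift 1 (?a t)
        + fps_X ^ (2 * qq P) * fps_const (R t / (2 * real (qq P)))) k
      = fps_nth (Abs_fps (\<lambda>k. Fcoeff P k (R t) (\<Psi> t) (phase P t))) k"
      by (intro always_eventually) (auto simp: fps_X_power_mult_nth Fcoeff_def)
  qed
qed

lemma dphase_expands:
  assumes "n \<le> 2 * qq P"
  shows "expands at_top x n (deriv (phase P)) (\<lambda>t. Abs_fps (dphase_coeff P))"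
proof (rule expands_polynomial[OF x_bigo assms])
  show "\<forall>\<^sub>F t in at_top. deriv (phase P) t
      = (\<Sum>k\<le>2 * qq P. fps_nth (Abs_fps (dphase_coeff P)) k * x t ^ k)"
    using eventually_gt_at_top[of 0] by eventually_elim (simp add: deriv_phase)
qed auto

lemma Gres_expands:
  assumes n: "n \<le> 2 * qq P"
  shows "expands at_top x n (\<lambda>t. Gres P (R t) (\<Psi> t) (phase P t) t)
     (\<lambda>t. Abs_fps (\<lambda>k. Gcoeff P k (R t) (\<Psi> t) (phase P t)))"
proof -
  have adm: "admissible_perturbation (rad P) (qq P) (shift P) (shift_coeff P)"
    using sys unfolding perturbed_system_def by blast
  have "expands at_top x n (\<lambda>t. - ratio P * deriv (phase P) t)
      (\<lambda>t. fps_const (- ratio P) * Abs_fps (dphase_coeff P))"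
    by (intro expands_mult dphase_expands expands_const x_bigo n) auto
  note expands_add[OF expands_add[OF freq_expands
      perturbation_expands[OF adm, of n "\<lambda>t. ratio P * phase P t + \<Psi> t" "phase P"]] this]
  then show ?thesis
    by (rule expands_cong) (auto intro!: always_eventually simp: Gres_def Gcoeff_def x_def)
qed

text \<open>The coordinate function \<open>R\<close> serves as the coefficient of order \<open>0\<close>.\<close>

lemma Utrunc_eq_sum:
  assumes "t > 0"
  shows "Utrunc P u N r p s t = (\<Sum>k\<le>N. x t ^ k * (u(0 := \<lambda>R \<Psi> S. R)) k r p s)"
proof -
  have "(\<Sum>k\<le>N. x t ^ k * (u(0 := \<lambda>R \<Psi> S. R)) k r p s)
     = r + (\<Sum>k=1..N. x t ^ k * (u(0 := \<lambda>R \<Psi> S. R)) k r p s)"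
    by (simp add: atMost_atLeast0 sum.atLeast_Suc_atMost)
  then show ?thesis
    using powr_eq_x_power[OF assms] by (simp add: Utrunc_def)
qed

text \<open>\<open>Utrunc\<close> is a polynomial in \<open>x\<close> that shares its coefficients
  up to index \<open>N\<close> with the full formal series. As \<open>n \<le> N\<close>, the
  discarded terms affect only powers above \<open>n\<close>, so the untruncated formal derivative is
  correct to order \<open>n\<close>.\<close>

lemma total_deriv_expands:
  assumes av: "averaging P u v \<Lambda> \<Omega>" and n: "n \<le> 2 * qq P" "n \<le> N"
  shows "expands at_top x n (\<lambda>t. total_deriv P (Utrunc P u N) (R t) (\<Psi> t) (phase P t) t)
     (\<lambda>t. formal_total_deriv P (u(0 := \<lambda>R \<Psi> S. R)) (R t) (\<Psi> t) (phase P t))"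
proof -
  define w where "w = u(0 := \<lambda>R \<Psi> S. R)"
  have w0: "w 0 = (\<lambda>R \<Psi> S. R)" by (simp add: w_def)
  have sm: "smooth_on UNIV (\<lambda>(R, \<Psi>, S). w k R \<Psi> S)"
    and per: "\<And>R \<Psi> S. w k R \<Psi> (S + 2 * pi * real (vkap P)) = w k R \<Psi> S" if "k \<ge> 1" for k
    using av that unfolding averaging_def w_def by auto
  have T: "2 * pi * real (vkap P) > 0"
    using sys unfolding perturbed_system_def by auto
  have diff: "(\<lambda>a'. w k a' b s) field_differentiable at a"
    "(\<lambda>b'. w k a b' s) field_differentiable at b"
    "(\<lambda>s'. w k a b s') field_differentiable at s" for k a b s
    using smooth_on_partials[OF sm, of k] by (cases "k = 0"; force simp: w0)+
  have bd: "(\<lambda>t. w k (R t) (\<Psi> t) (phase P t)) \<in> O[at_top](\<lambda>_. 1)"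
    "(\<lambda>t. deriv (\<lambda>a'. w k a' (\<Psi> t) (phase P t)) (R t)) \<in> O[at_top](\<lambda>_. 1)"
    "(\<lambda>t. deriv (\<lambda>b'. w k (R t) b' (phase P t)) (\<Psi> t)) \<in> O[at_top](\<lambda>_. 1)"
    "(\<lambda>t. deriv (\<lambda>s'. w k (R t) (\<Psi> t) s') (phase P t)) \<in> O[at_top](\<lambda>_. 1)" for k
    using periodic_partials_bounded[OF sm per T R \<Psi>, of k] R
    by (cases "k = 0"; simp add: w0)+
  have bd': "(\<lambda>t. - (real k / (2 * real (qq P))) * w k (R t) (\<Psi> t) (phase P t)) \<in> O[at_top](\<lambda>_. 1)" for k
    using bd(1)[of k] qq_pos by (cases "k = 0") auto
  have D: "deriv (\<lambda>a'. Utrunc P u N a' b s t) a = (\<Sum>k\<le>N. deriv (\<lambda>a'. w k a' b s) a * x t ^ k)"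
    "deriv (\<lambda>b'. Utrunc P u N a b' s t) b = (\<Sum>k\<le>N. deriv (\<lambda>b'. w k a b' s) b * x t ^ k)"
    "deriv (\<lambda>s'. Utrunc P u N a b s' t) s = (\<Sum>k\<le>N. deriv (\<lambda>s'. w k a b s') s * x t ^ k)"
    if "t > 0" for a b s t
    unfolding Utrunc_eq_sum[OF that] w_def[symmetric]
    by (rule DERIV_imp_deriv, auto intro!: derivative_eq_intros DERIV_sum
        field_differentiable_derivI diff simp: mult.commute)+
  have Dt: "deriv (\<lambda>t'. Utrunc P u N a b s t') t
     = x t ^ (2 * qq P) * (\<Sum>k\<le>N. - (real k / (2 * real (qq P))) * w k a b s * x t ^ k)"
    if "t > 0" for a b s t
  proof -
    have "((\<lambda>t'. Utrunc P u N a b s t') has_real_derivative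
       (\<Sum>k=1..N. - (real k / (2 * real (qq P))) * t powr (- (real k / (2 * real (qq P))) - 1) * u k a b s)) (at t)"
      unfolding Utrunc_def using that by (auto intro!: derivative_eq_intros DERIV_sum)
    then have "deriv (\<lambda>t'. Utrunc P u N a b s t') t =
       (\<Sum>k=1..N. - (real k / (2 * real (qq P))) * t powr (- (real k / (2 * real (qq P))) - 1) * u k a b s)"
      by (rule DERIV_imp_deriv)
    also have "\<dots> = (\<Sum>k=1..N. x t ^ (2 * qq P) * (- (real k / (2 * real (qq P))) * w k a b s * x t ^ k))"
    proof (intro sum.cong refl)
      fix k assume "k \<in> {1..N}"
      have "t powr (- (real k / (2 * real (qq P))) - 1) = x t ^ k * x t ^ (2 * qq P)"
        unfolding powr_eq_x_power[OF that, symmetric] inverse_eq_x_power[OF that, symmetric]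
        using that qq_pos by (simp add: powr_diff)
      then show "- (real k / (2 * real (qq P))) * t powr (- (real k / (2 * real (qq P))) - 1) * u k a b s
        = x t ^ (2 * qq P) * (- (real k / (2 * real (qq P))) * w k a b s * x t ^ k)"
        using \<open>k \<in> {1..N}\<close> by (simp add: w_def)
    qed
    \<comment> \<open>The added summand \<open>k = 0\<close> vanishes through its factor
      \<open>k\<close>, in accordance with the coordinate \<open>R\<close> having no explicit time
      dependence.\<close>
    also have "\<dots> = (\<Sum>k\<le>N. x t ^ (2 * qq P) * (- (real k / (2 * real (qq P))) * w k a b s * x t ^ k))"
      by (rule sum.mono_neutral_left) (auto simp: not_le)
    finally show ?thesis by (simp only: sum_distrib_left)
  qed
  \<comment> \<open>The series on the right is not cut at \<open>N\<close>; this is the place where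
    \<open>n \<le> N\<close> makes the two sides agree.\<close>
  have poly: "expands at_top x n (\<lambda>t. \<Sum>k\<le>N. c k t * x t ^ k) (\<lambda>t. Abs_fps (\<lambda>k. c k t))"
    if "\<And>k. c k \<in> O[at_top](\<lambda>_. 1)" for c
    by (rule expands_polynomial[OF x_bigo n(2)]) (use that in auto)
  have "expands at_top x n
    (\<lambda>t. Fres P (R t) (\<Psi> t) (phase P t) t * (\<Sum>k\<le>N. deriv (\<lambda>a'. w k a' (\<Psi> t) (phase P t)) (R t) * x t ^ k)
       + Gres P (R t) (\<Psi> t) (phase P t) t * (\<Sum>k\<le>N. deriv (\<lambda>b'. w k (R t) b' (phase P t)) (\<Psi> t) * x t ^ k)
       + deriv (phase P) t * (\<Sum>k\<le>N. deriv (\<lambda>s'. w k (R t) (\<Psi> t) s') (phase P t) * x t ^ k)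
       + x t ^ (2 * qq P) * (\<Sum>k\<le>N. - (real k / (2 * real (qq P))) * w k (R t) (\<Psi> t) (phase P t) * x t ^ k))
    (\<lambda>t. formal_total_deriv P w (R t) (\<Psi> t) (phase P t))"
    unfolding formal_total_deriv_def
    by (intro expands_add expands_mult Fres_expands Gres_expands dphase_expands
        expands_fps_X_power poly bd bd' x_bigo n(1))
  then show ?thesis
    unfolding w_def[symmetric]
  proof (rule expands_cong)
    show "\<forall>\<^sub>F t in at_top.
       Fres P (R t) (\<Psi> t) (phase P t) t * (\<Sum>k\<le>N. deriv (\<lambda>a'. w k a' (\<Psi> t) (phase P t)) (R t) * x t ^ k)
       + Gres P (R t) (\<Psi> t) (phase P t) t * (\<Sum>k\<le>N. deriv (\<lambda>b'. w k (R t) b' (phase P t)) (\<Psi> t) * x t ^ k)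
       + deriv (phase P) t * (\<Sum>k\<le>N. deriv (\<lambda>s'. w k (R t) (\<Psi> t) s') (phase P t) * x t ^ k)
       + x t ^ (2 * qq P) * (\<Sum>k\<le>N. - (real k / (2 * real (qq P))) * w k (R t) (\<Psi> t) (phase P t) * x t ^ k)
      = total_deriv P (Utrunc P u N) (R t) (\<Psi> t) (phase P t) t"
      using eventually_gt_at_top[of 0]
      by eventually_elim (simp only: total_deriv_def D Dt)
  qed auto
qed

end

section \<open>The leading term of the averaged series\<close>

lemma higher_deriv_zero: "(deriv ^^ i) (\<lambda>_. 0) = (\<lambda>_::real. 0::real)"
  by (induction i) auto

text \<open>For \<open>k < n\<close> the function \<open>H k\<close> vanishes identically, so all
  its Taylor coefficients do, whatever \<open>u\<close> and \<open>v\<close> are. In degree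
  \<open>n\<close> only \<open>k = n\<close> survives, with Taylor degree \<open>0\<close>, that is,
  with the plain value at \<open>(R, \<Psi>)\<close>.\<close>

lemma averaged_series_lowest:
  assumes "\<And>i \<rho> \<psi>. 1 \<le> i \<Longrightarrow> i < n \<Longrightarrow> H i \<rho> \<psi> = 0"
  shows "d < n \<Longrightarrow> fps_nth (averaged_series u v H R \<Psi> S) d = 0"
    and "1 \<le> n \<Longrightarrow> fps_nth (averaged_series u v H R \<Psi> S) n = H n R \<Psi>"
proof -
  have *: "formal_taylor (H k) R \<Psi> h l = 0" if "1 \<le> k" "k < n" for k h l
  proof -
    have "H k = (\<lambda>_ _. 0)" using assms[OF that] by blast
    then show ?thesis by (simp add: formal_taylor_def higher_deriv_zero fps_zero_def)
  qed
  then show "fps_nth (averaged_series u v H R \<Psi> S) d = 0" if "d < n"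
    using that by (auto simp: averaged_series_def intro!: sum.neutral)
  assume "1 \<le> n"
  then have "{1..n} = insert n {1..<n}" by auto
  moreover have "fps_nth (formal_taylor (H n) R \<Psi> h l) 0 = H n R \<Psi>" for h l
    by (simp add: formal_taylor_def)
  ultimately show "fps_nth (averaged_series u v H R \<Psi> S) n = H n R \<Psi>"
    using * by (simp add: averaged_series_def)
qed

text \<open>The oscillating phase has disappeared from the leading coefficient: the derivative has
  no term below \<open>x ^ n\<close>, and that of order \<open>n\<close> depends on \<open>R\<close>
  and \<open>\<Psi>\<close> alone.\<close>

lemma (in trajectory) total_deriv_leading_term:
  assumes av: "averaging P u v \<Lambda> \<Omega>" and n: "1 \<le> n" "n \<le> 2 * qq P" "n \<le> N"
    and zero: "\<And>i \<rho> \<psi>. 1 \<le> i \<Longrightarrow> i < n \<Longrightarrow> \<Lambda> i \<rho> \<psi> = 0"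
  shows "(\<lambda>t. total_deriv P (Utrunc P u N) (R t) (\<Psi> t) (phase P t) t - \<Lambda> n (R t) (\<Psi> t) * x t ^ n)
     \<in> O[at_top](\<lambda>t. x t ^ Suc n)"
proof -
  have "formal_total_deriv P (u(0 := \<lambda>R \<Psi> S. R)) (R t) (\<Psi> t) (phase P t)
     = averaged_series u v \<Lambda> (R t) (\<Psi> t) (phase P t)" for t
    using av unfolding averaging_def by blast
  moreover have "(\<Sum>k\<le>n. fps_nth (averaged_series u v \<Lambda> (R t) (\<Psi> t) (phase P t)) k * x t ^ k)
     = \<Lambda> n (R t) (\<Psi> t) * x t ^ n" for t
  proof -
    have "{..n} = insert n {..<n}" by auto
    then show ?thesis using averaged_series_lowest[of n \<Lambda>] zero n(1) by simp
  qed
  ultimately show ?thesis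
    using total_deriv_expands[OF av n(2,3)] unfolding expands_def by simp
qed

section \<open>The change of variables on bounded sets\<close>

text \<open>Over a principal filter, being \<open>O(1)\<close> means being bounded on the underlying
  set. This turns the estimate along functions into one uniform over a ball and over all
  \<open>S\<close>.\<close>

lemma averaging_coeff_bounded:
  assumes av: "averaging P u v \<Lambda> \<Omega>" and vk: "vkap P \<ge> 1" and w: "w \<in> {u, v}" "k \<ge> 1"
  shows "\<exists>C. \<forall>R \<Psi> S. norm (R, \<Psi>) \<le> M \<longrightarrow> \<bar>w k R \<Psi> S\<bar> \<le> C"
proof -
  have sm: "smooth_on UNIV (\<lambda>(R, \<Psi>, S). w k R \<Psi> S)"
    and per: "\<And>R \<Psi> S. w k R \<Psi> (S + 2 * pi * real (vkap P)) = w k R \<Psi> S"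
    using av w unfolding averaging_def by blast+
  let ?F = "principal {(z, S). norm (z :: real \<times> real) \<le> M} :: ((real \<times> real) \<times> real) filter"
  have "\<bar>a\<bar> \<le> M" "\<bar>b\<bar> \<le> M" if "norm (a, b) \<le> M" for a b :: real
    using norm_fst_le[of a b] norm_snd_le[of b a] that by auto
  then have "fst \<circ> fst \<in> O[?F](\<lambda>_. 1)" "snd \<circ> fst \<in> O[?F](\<lambda>_. 1)"
    by (auto intro!: bigoI[of _ M] simp: eventually_principal)
  from periodic_partials_bounded(1)[OF sm per _ this, of snd] vk
  have "(\<lambda>t. w k ((fst \<circ> fst) t) ((snd \<circ> fst) t) (snd t)) \<in> O[?F](\<lambda>_. 1)" by simp
  then obtain C where "\<forall>\<^sub>F t in ?F. \<bar>w k ((fst \<circ> fst) t) ((snd \<circ> fst) t) (snd t)\<bar> \<le> C"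
    by (auto elim!: landau_o.bigE)
  then show ?thesis by (auto simp: eventually_principal)
qed

text \<open>On the ball of radius \<open>M + 1\<close> the correction has norm at most
  \<open>1\<close> once \<open>t\<close> is large, which explains the enlarged radius. The threshold
  for \<open>t\<close> is uniform in \<open>S\<close> and \<open>y\<close>, so \<open>S\<close> may
  later be replaced by the phase at time \<open>t\<close>.\<close>

lemma near_identity_preimage:
  fixes P :: perturbed_data
  assumes sys: "perturbed_system P" and av: "averaging P u v \<Lambda> \<Omega>" and "M > 0"
  shows "\<forall>\<^sub>F t in at_top. \<forall>S. \<forall>y\<in>cball 0 M. \<exists>z\<in>cball 0 (M + 1). change_vars P u v N S t z = y"
proof -
  \<comment> \<open>The zero functions merely give access to \<open>x\<close> and its
    properties.\<close>
  interpret trajectory P "\<lambda>_. 0" "\<lambda>_. 0"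
    by standard (use sys in auto)
  have vk: "vkap P \<ge> 1" using sys unfolding perturbed_system_def by blast
  have "\<exists>C. \<forall>R \<Psi> S. norm (R, \<Psi>) \<le> M + 1 \<longrightarrow> \<bar>w k R \<Psi> S\<bar> \<le> C" if "w \<in> {u, v}" "k \<ge> 1" for w k
    using averaging_coeff_bounded[OF av vk that] .
  then have "\<forall>k. \<exists>C. k \<ge> 1 \<longrightarrow> (\<forall>R \<Psi> S. norm (R, \<Psi>) \<le> M + 1 \<longrightarrow> \<bar>u k R \<Psi> S\<bar> \<le> C)"
    "\<forall>k. \<exists>C. k \<ge> 1 \<longrightarrow> (\<forall>R \<Psi> S. norm (R, \<Psi>) \<le> M + 1 \<longrightarrow> \<bar>v k R \<Psi> S\<bar> \<le> C)"
    by blast+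
  then obtain Cu Cv where
    Cu: "\<And>k R \<Psi> S. k \<ge> 1 \<Longrightarrow> norm (R, \<Psi>) \<le> M + 1 \<Longrightarrow> \<bar>u k R \<Psi> S\<bar> \<le> Cu k" and
    Cv: "\<And>k R \<Psi> S. k \<ge> 1 \<Longrightarrow> norm (R, \<Psi>) \<le> M + 1 \<Longrightarrow> \<bar>v k R \<Psi> S\<bar> \<le> Cv k"
    by metis
  have cont: "continuous_on UNIV (\<lambda>z. w k (fst z) (snd z) S)" if "w \<in> {u, v}" "k \<ge> 1" for w k S
  proof -
    have "continuous_on UNIV (\<lambda>(R, \<Psi>, S). w k R \<Psi> S)"
      using av that unfolding averaging_def smooth_on_def by (blast intro: Ck_on_continuous)
    from continuous_on_compose2[OF this, of UNIV "\<lambda>z. (fst z, snd z, S)"]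
    show ?thesis by (simp add: continuous_intros)
  qed
  have "((\<lambda>t. \<Sum>k=1..N. x t ^ k * (Cu k + Cv k)) \<longlongrightarrow> (\<Sum>k=1..N. 0 ^ k * (Cu k + Cv k))) at_top"
    by (intro tendsto_intros x_tendsto)
  then have "\<forall>\<^sub>F t in at_top. dist (\<Sum>k=1..N. x t ^ k * (Cu k + Cv k)) (\<Sum>k=1..N. 0 ^ k * (Cu k + Cv k)) < 1"
    by (intro tendstoD) auto
  moreover have "(\<Sum>k=1..N. 0 ^ k * (Cu k + Cv k)) = 0"
    by (intro sum.neutral) auto
  ultimately have "\<forall>\<^sub>F t in at_top. (\<Sum>k=1..N. x t ^ k * (Cu k + Cv k)) < 1"
    by (auto simp: abs_less_iff elim: eventually_mono)
  then show ?thesis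
    using eventually_gt_at_top[of 0]
  proof eventually_elim
    case (elim t)
    note t = powr_eq_x_power[OF elim(2)]
    show ?case
    proof (intro allI ballI)
      fix S and y :: "real \<times> real" assume y: "y \<in> cball 0 M"
      \<comment> \<open>A fixed point of \<open>?f\<close> is exactly a preimage of
        \<open>y\<close>, the change of variables being the identity plus the subtracted
        pair.\<close>
      let ?f = "\<lambda>z. y - (\<Sum>k=1..N. x t ^ k * u k (fst z) (snd z) S, \<Sum>k=1..N. x t ^ k * v k (fst z) (snd z) S)"
      have "continuous_on (cball 0 (M + 1)) ?f"
        by (intro continuous_intros continuous_on_subset[OF cont]) auto
      moreover have "?f \<in> cball 0 (M + 1) \<rightarrow> cball 0 (M + 1)"
      proof
        fix z :: "real \<times> real" assume "z \<in> cball 0 (M + 1)"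
        then have z: "norm (fst z, snd z) \<le> M + 1" by simp
        have "\<bar>\<Sum>k=1..N. x t ^ k * u k (fst z) (snd z) S\<bar> \<le> (\<Sum>k=1..N. x t ^ k * Cu k)"
          using x_pos[OF elim(2)] Cu[OF _ z]
          by (intro order_trans[OF sum_abs] sum_mono) (auto simp: abs_mult mult_left_mono)
        moreover have "\<bar>\<Sum>k=1..N. x t ^ k * v k (fst z) (snd z) S\<bar> \<le> (\<Sum>k=1..N. x t ^ k * Cv k)"
          using x_pos[OF elim(2)] Cv[OF _ z]
          by (intro order_trans[OF sum_abs] sum_mono) (auto simp: abs_mult mult_left_mono)
        ultimately have "norm (\<Sum>k=1..N. x t ^ k * u k (fst z) (snd z) S,
            \<Sum>k=1..N. x t ^ k * v k (fst z) (snd z) S) \<le> 1"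
          using elim(1) by (intro order_trans[OF norm_Pair_le]) (simp add: sum.distrib distrib_left)
        then show "?f z \<in> cball 0 (M + 1)"
          using y by (simp del: diff_Pair) (meson add_mono norm_triangle_ineq4 order_trans)
      qed
      ultimately obtain z where z: "z \<in> cball 0 (M + 1)" "?f z = z"
        by (rule brouwer[of "cball 0 (M + 1)", rotated 3]) (use \<open>M > 0\<close> in auto)
      then have "change_vars P u v N S t z = y"
        unfolding change_vars_def Utrunc_def Vtrunc_def t
        by (auto simp: case_prod_beta prod_eq_iff)
      with z(1) show "\<exists>z\<in>cball 0 (M + 1). change_vars P u v N S t z = y" by blast
    qed
  qed
qed

text \<open>Since \<open>\<sigma> < 1\<close>, the power of \<open>t\<close> in
  \<open>dom_at\<close> tends to zero, and \<open>\<psi>\<close> is unrestricted, so the sections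
  eventually contain any ball. This places the Brouwer preimage inside the set on which injectivity
  is known.\<close>

lemma cball_subset_dom_at:
  assumes sys: "perturbed_system P" and "\<sigma> < 1"
  shows "\<forall>\<^sub>F t in at_top. cball 0 M \<subseteq> dom_at P \<sigma> 0 t"
proof -
  let ?e = "\<lambda>t. t powr (- ((1 - \<sigma>) / (2 * real (qq P))))"
  have P: "qq P \<ge> 1" "\<bar>res P\<bar> < rad P" using sys unfolding perturbed_system_def by auto
  have "(?e \<longlongrightarrow> 0) at_top"
    using P \<open>\<sigma> < 1\<close> by (intro tendsto_neg_powr filterlim_ident) auto
  then have "((\<lambda>t. M * ?e t) \<longlongrightarrow> M * 0) at_top" by (intro tendsto_intros)
  then have "\<forall>\<^sub>F t in at_top. dist (M * ?e t) (M * 0) < rad P - \<bar>res P\<bar>"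
    using P by (intro tendstoD) auto
  then show ?thesis
  proof eventually_elim
    case (elim t)
    show ?case
    proof
      fix z :: "real \<times> real" assume "z \<in> cball 0 M"
      then have "\<bar>fst z\<bar> \<le> M" using norm_fst_le[of "fst z" "snd z"] by simp
      then have "\<bar>fst z * ?e t\<bar> \<le> M * ?e t" by (simp add: abs_mult mult_right_mono)
      with elim show "z \<in> dom_at P \<sigma> 0 t" by (auto simp: dom_at_def case_prod_beta)
    qed
  qed
qed

lemma change_inv_bounded:
  assumes sys: "perturbed_system P" and av: "averaging P u v \<Lambda> \<Omega>" and "M > 0" and "\<sigma> < 1"
    and inv: "change_invertible P u v N \<sigma> \<epsilon> t0"
  shows "\<forall>\<^sub>F t in at_top. \<forall>y\<in>cball 0 M. change_inv P u v N \<sigma> (phase P t) t y \<in> cball 0 (M + 1)"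
  using near_identity_preimage[OF sys av \<open>M > 0\<close>, of N] cball_subset_dom_at[OF sys \<open>\<sigma> < 1\<close>, of "M + 1"]
    eventually_ge_at_top[of t0]
proof eventually_elim
  case (elim t)
  show ?case
  proof
    fix y :: "real \<times> real" assume "y \<in> cball 0 M"
    with elim(1) obtain z where z: "z \<in> cball 0 (M + 1)"
      "change_vars P u v N (phase P t) t z = y" by blast
    moreover have "inj_on (change_vars P u v N (phase P t) t) (dom_at P \<sigma> 0 t)"
      using inv elim(3) unfolding change_invertible_def by blast
    ultimately have "change_inv P u v N \<sigma> (phase P t) t y = z"
      unfolding change_inv_def using elim(2) by (auto intro: the_inv_into_f_eq)
    with z show "change_inv P u v N \<sigma> (phase P t) t y \<in> cball 0 (M + 1)" by simp
  qed
qed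

section \<open>Drift of constant sign and logarithmic growth\<close>

text \<open>Compactness would bound only the absolute value. The fixed sign \<open>s\<close>,
  without which the drift could reverse and cancel, comes from connectedness: the range of
  \<open>g\<close> is an interval avoiding zero.\<close>

lemma nonvanishing_lower_bound:
  fixes g :: "'a::euclidean_space \<Rightarrow> real"
  assumes g: "continuous_on UNIV g" and nz: "\<And>z. g z \<noteq> 0" and "compact K" "K \<noteq> {}"
  obtains s c where "s = 1 \<or> s = -1" "c > 0" "\<And>z. z \<in> K \<Longrightarrow> c \<le> s * g z"
proof -
  have "connected (range g)" using g connected_continuous_image connected_UNIV by blast
  then have iv: "is_interval (range g)" by (simp add: is_interval_connected_1)
  obtain s :: real where s: "s = 1 \<or> s = -1" "\<And>z. s * g z > 0"
  proof (cases "\<exists>z. g z < 0")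
    case True
    have "g z < 0" for z
    proof (rule ccontr)
      assume "\<not> g z < 0"
      with True iv have "0 \<in> range g"
        unfolding is_interval_1 by (meson not_less less_imp_le rangeI)
      with nz show False by auto
    qed
    then show ?thesis using that[of "-1"] by auto
  next
    case False
    then have "0 < g z" for z using nz[of z] by (metis linorder_cases)
    then show ?thesis using that[of 1] by simp
  qed
  have "continuous_on K (\<lambda>z. s * g z)"
    by (intro continuous_intros continuous_on_subset[OF g]) auto
  from continuous_attains_inf[OF \<open>compact K\<close> \<open>K \<noteq> {}\<close> this]
  obtain z0 where "\<forall>z\<in>K. s * g z0 \<le> s * g z" by blast
  with s show ?thesis using that[of s "s * g z0"] by blast
qed

text \<open>\<open>f - c * ln\<close> is nondecreasing, and \<open>ln\<close> is unbounded.\<close>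

lemma unbounded_if_deriv_ge_inverse:
  fixes f :: "real \<Rightarrow> real"
  assumes "c > 0" "T > 0"
    and D: "\<And>t. t \<ge> T \<Longrightarrow> (f has_real_derivative f' t) (at t) \<and> c / t \<le> f' t"
  shows "\<exists>t\<ge>T. f t > M"
proof -
  have mono: "f T - c * ln T \<le> f t - c * ln t" if "T \<le> t" for t
  proof (rule DERIV_nonneg_imp_nondecreasing[OF that])
    fix s assume "T \<le> s" "s \<le> t"
    then show "\<exists>y. ((\<lambda>t. f t - c * ln t) has_real_derivative y) (at s) \<and> 0 \<le> y"
      using D[of s] \<open>T > 0\<close>
      by (intro exI[of _ "f' s - c * (1 / s)"]) (auto intro!: derivative_eq_intros)
  qed
  have "\<forall>\<^sub>F t in at_top. ln t > (M - f T + c * ln T) / c"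
    using ln_at_top by (simp add: filterlim_at_top_dense)
  then obtain t where t: "t \<ge> T" "ln t > (M - f T + c * ln T) / c"
    by (metis eventually_at_top_linorder nle_le)
  then have "c * ln t > M - f T + c * ln T" using \<open>c > 0\<close> by (simp add: field_simps)
  with mono[OF t(1)] have "f t > M" by linarith
  with t show ?thesis by blast
qed

theorem theorem6:
  fixes P :: perturbed_data
    and u v :: "nat \<Rightarrow> real \<Rightarrow> real \<Rightarrow> real \<Rightarrow> real"
    and \<Lambda> \<Omega> :: "nat \<Rightarrow> real \<Rightarrow> real \<Rightarrow> real"
    and n m N :: nat and \<sigma> \<epsilon> t0 :: real
  assumes "perturbed_system P"
    and "averaging P u v \<Lambda> \<Omega>"
    and "1 \<le> n" "n \<le> 2 * qq P" "2 \<le> m" "m \<le> 2 * qq P"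
    and "\<forall>i. 1 \<le> i \<and> i < n \<longrightarrow> (\<forall>\<rho> \<psi>. \<Lambda> i \<rho> \<psi> = 0)"
    and "\<exists>\<rho> \<psi>. \<Lambda> n \<rho> \<psi> \<noteq> 0"
    and "\<forall>j. 1 < j \<and> j < m \<longrightarrow> (\<forall>\<rho> \<psi>. \<Omega> j \<rho> \<psi> = 0)"
    and "\<exists>\<rho> \<psi>. \<Omega> m \<rho> \<psi> \<noteq> 0"
    and "\<forall>\<rho> \<psi>. \<Lambda> n \<rho> \<psi> \<noteq> 0"
    and "n \<le> N"
    and "0 < \<sigma>" "\<sigma> < 1" "0 < \<epsilon>" "\<epsilon> < rad P"
    and "1 \<le> t0" "change_invertible P u v N \<sigma> \<epsilon> t0"
  shows "\<forall>B t1 \<rho> \<psi>. open B \<and> connected B \<and> bounded B \<and> t0 \<le> t1 \<and>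
           transformed_solution P u v N \<sigma> \<epsilon> t1 \<rho> \<psi> \<and> (\<rho> t1, \<psi> t1) \<in> B
           \<longrightarrow> (\<exists>t\<ge>t1. (\<rho> t, \<psi> t) \<notin> B)"
proof (intro allI impI, rule ccontr)
  fix B t1 \<rho> \<psi>
  assume *: "open B \<and> connected B \<and> bounded B \<and> t0 \<le> t1 \<and>
      transformed_solution P u v N \<sigma> \<epsilon> t1 \<rho> \<psi> \<and> (\<rho> t1, \<psi> t1) \<in> B"
    and "\<not> (\<exists>t\<ge>t1. (\<rho> t, \<psi> t) \<notin> B)"
  then have stay: "(\<rho> t, \<psi> t) \<in> B" if "t \<ge> t1" for t using that by blast
  obtain M where M: "M > 0" "\<And>y. y \<in> B \<Longrightarrow> norm y \<le> M"
    using * bounded_pos[of B] by auto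
  define Z where "Z t = change_inv P u v N \<sigma> (phase P t) t (\<rho> t, \<psi> t)" for t
  define R where "R t = fst (Z t)" for t
  define \<Psi> where "\<Psi> t = snd (Z t)" for t
  have Zbd: "\<forall>\<^sub>F t in at_top. norm (Z t) \<le> M + 1"
    using change_inv_bounded[OF assms(1,2) M(1) \<open>\<sigma> < 1\<close> assms(18)] eventually_ge_at_top[of t1]
    by eventually_elim (use stay M in \<open>auto simp: Z_def\<close>)
  interpret trajectory P R \<Psi>
  proof
    show "R \<in> O[at_top](\<lambda>_. 1)"
      by (rule bigoI[of _ "M + 1"], rule eventually_mono[OF Zbd])
         (use norm_fst_le[of "R t" "\<Psi> t" for t] in \<open>auto simp: R_def \<Psi>_def intro: order_trans\<close>)
    show "\<Psi> \<in> O[at_top](\<lambda>_. 1)"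
      by (rule bigoI[of _ "M + 1"], rule eventually_mono[OF Zbd])
         (use norm_snd_le[of "\<Psi> t" "R t" for t] in \<open>auto simp: R_def \<Psi>_def intro: order_trans\<close>)
  qed (fact assms(1))
  have "smooth_on UNIV (\<lambda>(\<rho>, \<psi>). \<Lambda> n \<rho> \<psi>)"
    using assms(2,3) unfolding averaging_def by blast
  then have "continuous_on UNIV (\<lambda>(\<rho>, \<psi>). \<Lambda> n \<rho> \<psi>)"
    unfolding smooth_on_def by (blast intro: Ck_on_continuous)
  then obtain s c where s: "s = 1 \<or> s = -1" and c: "c > 0"
      and sc: "\<And>z. z \<in> cball 0 (M + 1) \<Longrightarrow> c \<le> s * (case z of (\<rho>, \<psi>) \<Rightarrow> \<Lambda> n \<rho> \<psi>)"
    by (rule nonvanishing_lower_bound[where K = "cball 0 (M + 1)"]) (use assms(11) M in auto)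
  define D where "D t = total_deriv P (Utrunc P u N) (R t) (\<Psi> t) (phase P t) t" for t
  have "(\<lambda>t. D t - \<Lambda> n (R t) (\<Psi> t) * x t ^ n) \<in> O[at_top](\<lambda>t. x t ^ Suc n)"
    unfolding D_def using total_deriv_leading_term[OF assms(2,3,4,12)] assms(7) by blast
  then obtain E where E: "E > 0"
    "\<forall>\<^sub>F t in at_top. norm (D t - \<Lambda> n (R t) (\<Psi> t) * x t ^ n) \<le> E * norm (x t ^ Suc n)"
    by (rule landau_o.bigE)
  \<comment> \<open>Below this size the error \<open>E * x ^ (n + 1)\<close> is at most half of the
    leading term \<open>c * x ^ n\<close>.\<close>
  have "\<forall>\<^sub>F t in at_top. dist (x t) 0 < c / (2 * E)"
    using c E by (intro tendstoD x_tendsto) auto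
  with E(2) Zbd have "\<forall>\<^sub>F t in at_top. c / 2 / t \<le> s * D t"
    using eventually_ge_at_top[of 1]
  proof eventually_elim
    case (elim t)
    have x: "0 < x t" "x t \<le> 1"
      using elim(4) powr_mono[of "- 1 / (2 * real (qq P))" 0 t] by (auto simp: x_def)
    have "c * x t ^ n \<le> s * \<Lambda> n (R t) (\<Psi> t) * x t ^ n"
      using sc[of "Z t"] elim(2) x by (intro mult_right_mono) (auto simp: R_def \<Psi>_def case_prod_beta)
    moreover have "\<bar>s * (D t - \<Lambda> n (R t) (\<Psi> t) * x t ^ n)\<bar> \<le> c / 2 * x t ^ n"
    proof -
      have "\<bar>s * (D t - \<Lambda> n (R t) (\<Psi> t) * x t ^ n)\<bar> \<le> E * x t * x t ^ n"
        using elim(1) x s by (auto simp: abs_mult mult_ac)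
      also have "\<dots> \<le> c / 2 * x t ^ n"
        using elim(3) x E by (intro mult_right_mono) (auto simp: field_simps)
      finally show ?thesis .
    qed
    moreover have "s * (D t - \<Lambda> n (R t) (\<Psi> t) * x t ^ n) = s * D t - s * \<Lambda> n (R t) (\<Psi> t) * x t ^ n"
      by (simp add: algebra_simps)
    ultimately have "c / 2 * x t ^ n \<le> s * D t" by linarith
    \<comment> \<open>Here \<open>n \<le> 2 * qq P\<close> enters: \<open>1 / t\<close> is
      \<open>x t ^ (2 * qq P)\<close> and \<open>x t \<le> 1\<close>.\<close>
    moreover have "c / 2 * (1 / t) \<le> c / 2 * x t ^ n"
      using inverse_eq_x_power[of t] elim(4) c x assms(4)
      by (intro mult_left_mono) (auto intro: power_decreasing)
    ultimately show ?case by simp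
  qed
  then obtain T0 where T0: "\<And>t. t \<ge> T0 \<Longrightarrow> c / 2 / t \<le> s * D t"
    by (auto simp: eventually_at_top_linorder)
  \<comment> \<open>Beyond \<open>t1 + 1\<close> the point is interior to \<open>{t1..}\<close>, so
    the derivative within that set is two-sided; the \<open>1\<close> makes \<open>T\<close>
    positive for the logarithm.\<close>
  define T where "T = max T0 (max 1 (t1 + 1))"
  have "\<exists>t\<ge>T. s * \<rho> t > M"
  proof (rule unbounded_if_deriv_ge_inverse[where c = "c / 2" and f' = "\<lambda>t. s * D t"])
    fix t assume t: "T \<le> t"
    \<comment> \<open>\<open>\<Lambda>_rhs\<close> is by definition the total derivative of
      \<open>Utrunc\<close> at the inverse image, so it equals \<open>D t\<close> exactly.\<close>
    have "(\<rho> has_real_derivative D t) (at t within {t1..})"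
      using * t unfolding transformed_solution_def T_def D_def \<Lambda>_rhs_def R_def \<Psi>_def Z_def
      by (auto simp: case_prod_beta)
    then have "(\<rho> has_real_derivative D t) (at t)"
      using t at_within_interior[of t "{t1..}"] by (auto simp: T_def)
    then show "((\<lambda>t. s * \<rho> t) has_real_derivative s * D t) (at t) \<and> c / 2 / t \<le> s * D t"
      using T0[of t] t by (auto simp: T_def intro: DERIV_cmult)
  qed (use c in \<open>auto simp: T_def\<close>)
  then obtain t where t: "t \<ge> T" "s * \<rho> t > M" by blast
  then have "\<bar>\<rho> t\<bar> > M" using s by auto
  moreover have "\<bar>\<rho> t\<bar> \<le> M"
    using M(2)[OF stay[of t]] norm_fst_le[of "\<rho> t" "\<psi> t"] t(1) by (auto simp: T_def)
  ultimately show False by simp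
qed

end
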